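(* For every graph \(G\) on \(n\) vertices, every tree decomposition \((T,\mathcal{X})\) of \(G\) of width \(t-1\), and every \(m\in\{1,\dots,n\}\), there is a partition \((B,W)\) of \(V(G)\) with \(|B|=m\) and \[e_G(B,W)\leq \tfrac12 t\,\Delta(G)\left(\left(\log_2 \tfrac{1}{r(T,\mathcal{X})}\right)^2 + 9\log_2\tfrac{1}{r(T,\mathcal{X})} + 8\right).\]
   Context: \(e_G(B,W)\) is the number of edges with one end in \(B\) and the other in \(W\); \(\Delta(G)\) is the maximum degree. A tree decomposition of \(G\) is a pair \((T,\mathcal{X})\) where \(T\) is a tree and \(\mathcal{X}=(X^i)_{i\in V(T)}\) with \(X^i\subseteq V(G)\), such that every vertex of \(G\) lies in some \(X^i\), every edge of \(G\) is contained in some \(X^i\), and for all nodes \(i,j\) and every node \(h\) on the \(i\)–\(j\) path in \(T\), \(X^i\cap X^j\subseteq X^h\). Its width is \(\max_i|X^i|-1\). For a path \(P\subseteq T\), \(w^*(P,\mathcal{X}) := |\bigcup_{i\in V(P)}X^i|/n\), and \(r(T,\mathcal{X}) := \max_{P\text{ path in }T} w^*(P,\mathcal{X})\). *)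

theory Defs
  imports Complex_Main "Graph_Theory.Graph_Theory"
begin

text \<open>
  Finite simple graphs are modelled by \<^locale>\<open>pair_graph\<close>: a finite vertex set with a symmetric,
  irreflexive set of arcs, an undirected edge \<open>uv\<close> being the pair of arcs \<open>(u,v)\<close>, \<open>(v,u)\<close>.
\<close>

definition cut_edges :: "'a pair_pre_digraph \<Rightarrow> 'a set \<Rightarrow> 'a set \<Rightarrow> nat" where
  "cut_edges G B W = card {{u, v} | u v. (u, v) \<in> parcs G \<and> u \<in> B \<and> v \<in> W}"

definition max_degree :: "'a pair_pre_digraph \<Rightarrow> nat" where
  "max_degree G = Max (out_degree G ` pverts G)"

text \<open>
  The library's \<^const>\<open>tree\<close> is not usable for symmetric digraphs: there the two arcs of a single
  edge already form a \<^const>\<open>pre_digraph.cycle\<close>. Undirected cycles are those of length at least 3.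
\<close>

definition undirected_tree :: "'b pair_pre_digraph \<Rightarrow> bool" where
  "undirected_tree T \<longleftrightarrow> pair_graph T \<and> Digraph_Component.connected T \<and>
     \<not> (\<exists>p. pre_digraph.cycle T p \<and> length p \<ge> 3)"

definition tree_decomposition ::
  "'a pair_pre_digraph \<Rightarrow> 'b pair_pre_digraph \<Rightarrow> ('b \<Rightarrow> 'a set) \<Rightarrow> bool" where
  "tree_decomposition G T X \<longleftrightarrow>
     undirected_tree T \<and>
     (\<forall>i \<in> pverts T. X i \<subseteq> pverts G) \<and>
     (\<forall>v \<in> pverts G. \<exists>i \<in> pverts T. v \<in> X i) \<and>
     (\<forall>(u, v) \<in> parcs G. \<exists>i \<in> pverts T. {u, v} \<subseteq> X i) \<and>
     (\<forall>i \<in> pverts T. \<forall>j \<in> pverts T. \<forall>p. vpath p T \<and> hd p = i \<and> last p = j \<longrightarrow>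
        (\<forall>h \<in> set p. X i \<inter> X j \<subseteq> X h))"

text \<open>Integer-valued, so that the width is \<open>-1\<close> (not \<open>0\<close>) if all bags are empty.\<close>

definition td_width :: "'b pair_pre_digraph \<Rightarrow> ('b \<Rightarrow> 'a set) \<Rightarrow> int" where
  "td_width T X = int (Max ((\<lambda>i. card (X i)) ` pverts T)) - 1"

text \<open>A path of \<open>T\<close> is given by the list of its vertices, of which \<^const>\<open>vpath\<close> requires at least one.\<close>

definition path_weight :: "'a pair_pre_digraph \<Rightarrow> ('b \<Rightarrow> 'a set) \<Rightarrow> 'b list \<Rightarrow> real" where
  "path_weight G X p = real (card (\<Union>i \<in> set p. X i)) / real (card (pverts G))"

definition max_path_weight ::
  "'a pair_pre_digraph \<Rightarrow> 'b pair_pre_digraph \<Rightarrow> ('b \<Rightarrow> 'a set) \<Rightarrow> real" where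
  "max_path_weight G T X = Max {path_weight G X p | p. vpath p T}"

end

theory Submission
  imports Defs
begin

text \<open>
  Let \<open>R\<close> be the union of the bags on a heaviest path and \<open>r = |R| / n\<close>. One shows that for every \<open>m\<close> the
  vertices split into \<open>B\<close>, \<open>W\<close>, \<open>Z\<close> with \<open>|B| \<le> m \<le> |B| + |Z|\<close>, at most \<open>t \<Delta> (log (1/r) + 4)\<close> edges
  between different parts, and \<open>R\<close> at least twice as dense in \<open>Z\<close> as in the whole graph. Iterating inside
  \<open>Z\<close> gives the bound, since \<open>f L = (L\<^sup>2 + 9 L + 8) / 2\<close> satisfies \<open>f L - f (L - 1) = L + 4\<close>.

  For the splitting, order the vertices cyclically along the path: each path node \<open>i\<close> contributes the
  vertices of \<open>R\<close> whose first bag is \<open>i\<close>, followed by the vertices hanging off the path at \<open>i\<close>. Cutting the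
  cycle next to a vertex of \<open>R\<close>, or detaching the vertices hanging at a node, only affects edges at one bag.
  If two elements of \<open>R\<close> are at distance \<open>m\<close>, two such cuts suffice. Otherwise the shift of \<open>R\<close> by \<open>m\<close>
  lands in hanging parts; averaging over the hanging parts that are hit yields one, \<open>S\<close>, such that the elements of
  \<open>R\<close> hitting it together with the stretch up to the next hit part are dense enough to serve as \<open>Z\<close>. The
  remaining imbalance is repaired up to an error \<open>|Z|\<close> by cutting inside \<open>S\<close> along centroid bags.
\<close>

section \<open>Cyclic arrangements\<close>

lemma card_hull_bounds:
  fixes Q :: "nat set"
  assumes "finite Q" "Q \<noteq> {}"
  shows "Q \<subseteq> {Min Q..Max Q}" "card Q \<le> card {Min Q..Max Q}"
proof -
  show "Q \<subseteq> {Min Q..Max Q}"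
    using assms by auto
  then show "card Q \<le> card {Min Q..Max Q}"
    by (intro card_mono) auto
qed

text \<open>
  The positions are rotated so that \<open>{n - s..<n}\<close> is the hanging part \<open>S\<close>, \<open>Q\<close> is the set of elements of \<open>R\<close>
  that the shift by \<open>m\<close> moves into \<open>S\<close>, and \<open>{..<q}\<close> is the stretch up to the next hit part. Each element of \<open>C\<close>
  stands for a bag that is given up, so the bound on \<open>2 ^ card C\<close> trades bags on the path against halving
  steps inside \<open>S\<close>.
\<close>

lemma arc_separation:
  fixes n m s q :: nat and R :: "nat set"
  defines "Q \<equiv> {x \<in> R. n - s \<le> (x + m) mod n}"
  assumes R: "R \<subseteq> {..<n - s}" "R \<noteq> {}" and s: "0 < s" "s \<le> n" and m: "2 * m \<le> n" and q: "q \<le> n - s"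
    and Q: "Q \<noteq> {}"
    and unhit: "\<forall>x\<in>R. q \<le> (x + m) mod n"
    and nexthit: "R \<subseteq> {..<q} \<or> (\<exists>x \<in> R - Q. q \<le> (x + m) mod n \<and> {q..(x + m) mod n} \<inter> R = {})"
    and heavy: "2 * card R * (s + q) \<le> n * (card Q + card (R \<inter> {..<q}))"
  shows "\<exists>Z B C. Z \<subseteq> {..<n - s} \<and> B \<subseteq> {..<n - s} \<and> Z \<inter> B = {} \<and> Z \<noteq> {} \<and>
     card B \<le> m \<and> m \<le> card B + card Z + s \<and>
     2 * card R * card Z \<le> n * card (R \<inter> Z) \<and>
     finite C \<and> C \<subseteq> R \<union> {q, n - s} \<and> n - s \<in> C \<and> card C \<le> 4 \<and>
     2 ^ card C * (card R * s) \<le> 8 * (n * card Z) \<and>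
     (\<forall>u v. u < v \<and> v < n \<and> ((u \<in> Z) \<noteq> (v \<in> Z) \<or> (u \<in> B) \<noteq> (v \<in> B)) \<longrightarrow>
        (\<exists>z \<in> C \<inter> R. u \<le> z \<and> z \<le> v) \<or> q \<in> C \<and> u < q \<and> q \<le> v \<or> u < n - s \<and> n - s \<le> v)"
proof -
  have finR: "finite R"
    using R finite_subset by blast
  show ?thesis
  proof (cases "n \<le> 2 * s")
    \<comment> \<open>\<open>S\<close> fills at least half of the cycle, so its whole complement,
      which contains \<open>R\<close>, can serve as \<open>Z\<close> with a single cut.\<close>
    case True
    have "R \<inter> {..<n - s} = R" using R by auto
    moreover have "{..<n - s} \<noteq> {}" using R by auto
    moreover have "card R \<le> n - s"
      using card_mono[OF _ R(1)] by simp
    then have "card R * s \<le> (n - s) * n"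
      using s by (intro mult_mono) auto
    then have "2 * (card R * s) \<le> 8 * (n * (n - s))"
      by (simp add: mult.commute)
    moreover have "2 * card R * (n - s) \<le> n * card R"
    proof -
      have "2 * (n - s) \<le> n" using True by linarith
      then show ?thesis using mult_le_mono1[of "2 * (n - s)" n "card R"] by (simp only: ac_simps)
    qed
    moreover have "m \<le> n" using m by simp
    moreover have "u < n - s \<and> n - s \<le> v" if "u < v" "(u \<in> {..<n - s}) \<noteq> (v \<in> {..<n - s})" for u v
      using that by auto
    ultimately show ?thesis
      using s by - (rule exI[of _ "{..<n - s}"], rule exI[of _ "{}"], rule exI[of _ "{n - s}"], simp, blast)
  next
    case False
    then have small: "2 * s < n" by simp
    \<comment> \<open>Adding \<open>m\<close> wraps no element of \<open>Q\<close> around, since a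
      wrapped position would lie below \<open>n - s\<close>. So \<open>Q\<close> lies in a window of
      \<open>s\<close> consecutive positions.\<close>
    have Qmod: "x + m < n \<and> n \<le> x + m + s" if "x \<in> Q" for x
    proof -
      have x: "x < n - s" "n - s \<le> (x + m) mod n"
        using that R by (auto simp: Q_def)
      have "x + m < n"
      proof (rule ccontr)
        assume "\<not> x + m < n"
        then have "(x + m) mod n = x + m - n"
          using x m small by (simp add: mod_if)
        then show False using x m small by simp
      qed
      then show ?thesis using x s by auto
    qed
    have QR: "Q \<subseteq> R" by (auto simp: Q_def)
    have finQ: "finite Q" using QR finR finite_subset by blast
    have hull: "\<exists>x y. x \<in> P \<and> y \<in> P \<and> x \<le> y \<and> P \<subseteq> {x..y} \<and> card P \<le> Suc y - x"
      if "P \<subseteq> R" "P \<noteq> {}" for P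
    proof -
      have "finite P" using that finR finite_subset by blast
      then show ?thesis
        using that card_hull_bounds[of P]
        by (intro exI[of _ "Min P"] exI[of _ "Max P"]) auto
    qed
    let ?a = "card Q" and ?e = "card (R \<inter> {..<q})"
    \<comment> \<open>Any dense enough \<open>P\<close> inside \<open>Q\<close> suffices:
      \<open>Z\<close> is its hull and \<open>B\<close> the gap between the hull and
      \<open>S\<close>. The shift of the last point reaches \<open>S\<close>, so the gap has at most
      \<open>m\<close> elements; the shift of the first point stays below \<open>n\<close>, so gap,
      hull and \<open>S\<close> together have more than \<open>m\<close>.\<close>
    have single: ?thesis
      if P: "P \<subseteq> Q" "P \<noteq> {}" and dense: "\<And>x y. x \<in> P \<Longrightarrow> y \<in> P \<Longrightarrow> 2 * card R * (Suc y - x) \<le> n * card P"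
        and large: "card R * s \<le> n * card P" for P
    proof -
      obtain x y where xy: "x \<in> P" "y \<in> P" "x \<le> y" "P \<subseteq> {x..y}" "card P \<le> Suc y - x"
        using hull[of P] P QR by auto
      have xR: "x \<in> R" "y \<in> R" using xy P QR by auto
      have bounds: "x + m < n" "n \<le> y + m + s" "y < n - s"
        using Qmod[of x] Qmod[of y] xy P QR R by auto
      have "card P \<le> card (R \<inter> {x..y})"
        using xy P QR finR by (intro card_mono) auto
      then have "n * card P \<le> n * card (R \<inter> {x..y})" by simp
      then have d: "2 * card R * (Suc y - x) \<le> n * card (R \<inter> {x..y})"
        using dense[OF xy(1,2)] by linarith
      have c3: "card {x, y, n - s} \<le> 3"
        by (simp add: card_insert_if)
      then have "2 ^ card {x, y, n - s} * (card R * s) \<le> 2 ^ 3 * (card R * s)"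
        by (intro mult_right_mono power_increasing) auto
      also have "\<dots> \<le> 2 ^ 3 * (n * (Suc y - x))"
        by (intro mult_le_mono2 order_trans[OF large] xy(5))
      finally have l: "2 ^ card {x, y, n - s} * (card R * s) \<le> 8 * (n * (Suc y - x))" by simp
      show ?thesis
      proof (rule exI[of _ "{x..y}"], rule exI[of _ "{y<..<n - s}"], rule exI[of _ "{x, y, n - s}"], intro conjI allI impI)
        fix u v
        assume uv: "u < v \<and> v < n \<and> ((u \<in> {x..y}) \<noteq> (v \<in> {x..y}) \<or> (u \<in> {y<..<n - s}) \<noteq> (v \<in> {y<..<n - s}))"
        show "(\<exists>z \<in> {x, y, n - s} \<inter> R. u \<le> z \<and> z \<le> v) \<or> q \<in> {x, y, n - s} \<and> u < q \<and> q \<le> v \<or> u < n - s \<and> n - s \<le> v"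
        proof (rule ccontr)
          assume "\<not> ?thesis"
          then have "\<not> (u \<le> x \<and> x \<le> v)" "\<not> (u \<le> y \<and> y \<le> v)" "\<not> (u < n - s \<and> n - s \<le> v)"
            using xR by auto
          then have "x \<le> u \<longleftrightarrow> x \<le> v" "u \<le> y \<longleftrightarrow> v \<le> y" "u < n - s \<longleftrightarrow> v < n - s"
            using uv by linarith+
          then show False using uv by auto
        qed
      qed (use xy xR bounds d l c3 in auto)
    qed
    show ?thesis
    proof (cases "2 * card R * s \<le> n * ?a")
      case True
      show ?thesis
      proof (rule single[of Q])
        fix x y assume "x \<in> Q" "y \<in> Q"
        then have "Suc y - x \<le> s" using Qmod[of x] Qmod[of y] by linarith
        then have "2 * card R * (Suc y - x) \<le> 2 * card R * s" by (intro mult_le_mono2)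
        then show "2 * card R * (Suc y - x) \<le> n * ?a" using True by linarith
      qed (use Q True in auto)
    next
      case light: False
      \<comment> \<open>As \<open>Q\<close> is too sparse compared with \<open>S\<close>, the weight
        in \<open>heavy\<close> must come from the stretch: \<open>{..<q}\<close> alone is
        dense.\<close>
      have eq: "2 * card R * q \<le> n * ?e"
        using heavy light by (simp add: algebra_simps)
      show ?thesis
      proof (cases "Q \<inter> {..<q} = {}")
        case True
        obtain x y where xy: "x \<in> Q" "y \<in> Q" "x \<le> y" "Q \<subseteq> {x..y}" "card Q \<le> Suc y - x"
          using hull[of Q] Q QR by auto
        have xR: "x \<in> R" "y \<in> R" using xy QR by auto
        have bounds: "x + m < n" "n \<le> x + m + s" "y + m < n" "n \<le> y + m + s" "y < n - s"
          using Qmod[of x] Qmod[of y] xy QR R by auto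
        \<comment> \<open>The hull of \<open>Q\<close> starts at or after \<open>q\<close>, so hull
          and stretch contribute disjoint subsets of \<open>R\<close>, and \<open>heavy\<close>
          makes their union dense.\<close>
        define Z where "Z = {x..y} \<union> {..<q}"
        define B where "B = {x..<n - s} - Z"
        define C where "C = {x, y, q, n - s}"
        have finZ: "finite Z" by (simp add: Z_def)
        have "card Z \<le> (Suc y - x) + q"
          unfolding Z_def by (rule order_trans[OF card_Un_le]) simp
        then have cardZ: "card Z \<le> s + q" using bounds by linarith
        have "card (Q \<union> (R \<inter> {..<q})) = ?a + ?e"
          using True finQ finR QR by (intro card_Un_disjoint) auto
        moreover have "card (Q \<union> (R \<inter> {..<q})) \<le> card (R \<inter> Z)"
          using xy QR finR by (intro card_mono) (auto simp: Z_def)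
        ultimately have ae: "?a + ?e \<le> card (R \<inter> Z)" by simp
        have "2 * card R * card Z \<le> 2 * card R * (s + q)"
          using cardZ by (intro mult_le_mono2)
        also have "\<dots> \<le> n * card (R \<inter> Z)"
          using heavy mult_le_mono2[OF ae, of n] by linarith
        finally have dense: "2 * card R * card Z \<le> n * card (R \<inter> Z)" .
        have "card (R \<inter> Z) \<le> card Z" using finZ by (intro card_mono) auto
        then have "n * (?a + ?e) \<le> n * card Z" using ae by (intro mult_le_mono2) linarith
        \<comment> \<open>Up to four cuts are made here instead of three; the factor
          \<open>2\<close> in \<open>heavy\<close> pays for the fourth.\<close>
        then have "2 * (card R * s) \<le> n * card Z"
          using heavy by (simp add: algebra_simps)
        moreover have cC: "card C \<le> 4"
          by (simp add: card_insert_if C_def)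
        then have "2 ^ card C * (card R * s) \<le> 2 ^ 4 * (card R * s)"
          by (intro mult_right_mono power_increasing) auto
        moreover have "2 ^ 4 * (card R * s) = 8 * (2 * (card R * s))" by simp
        ultimately have l: "2 ^ card C * (card R * s) \<le> 8 * (n * card Z)" by linarith
        have "card B \<le> card {y<..<n - s}"
          by (intro card_mono) (auto simp: B_def Z_def)
        then have B1: "card B \<le> m" using bounds by auto
        have "card {x..<n - s} \<le> card (B \<union> Z)"
          using finZ by (intro card_mono) (auto simp: B_def)
        also have "\<dots> \<le> card B + card Z" by (rule card_Un_le)
        finally have B2: "m \<le> card B + card Z + s" using bounds by auto
        have sep: "(\<exists>z \<in> C \<inter> R. u \<le> z \<and> z \<le> v) \<or> q \<in> C \<and> u < q \<and> q \<le> v \<or> u < n - s \<and> n - s \<le> v"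
          if "u < v" "(u \<in> Z) \<noteq> (v \<in> Z) \<or> (u \<in> B) \<noteq> (v \<in> B)" for u v
        proof (rule ccontr)
          assume "\<not> ?thesis"
          then have *: "\<not> (u \<le> x \<and> x \<le> v)" "\<not> (u \<le> y \<and> y \<le> v)" "\<not> (u < q \<and> q \<le> v)" "\<not> (u < n - s \<and> n - s \<le> v)"
            using xR by (auto simp: C_def)
          then have "x \<le> u \<longleftrightarrow> x \<le> v" "u \<le> y \<longleftrightarrow> v \<le> y" "u < q \<longleftrightarrow> v < q" "u < n - s \<longleftrightarrow> v < n - s"
            using \<open>u < v\<close> by linarith+
          then show False using that by (auto simp: Z_def B_def)
        qed
        show ?thesis
        proof (rule exI[of _ Z], rule exI[of _ B], rule exI[of _ C], intro conjI allI impI)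
          show "Z \<subseteq> {..<n - s}" using bounds q by (auto simp: Z_def)
          show "Z \<noteq> {}" using xy by (auto simp: Z_def)
          show "Z \<inter> B = {}" "B \<subseteq> {..<n - s}" by (auto simp: B_def)
          show "finite C" "C \<subseteq> R \<union> {q, n - s}" "n - s \<in> C" using xR by (auto simp: C_def)
        qed (use B1 B2 dense cC l sep in blast)+
      next
        case False
        then obtain x0 where x0: "x0 \<in> Q" "x0 < q" by auto
        \<comment> \<open>Together with \<open>2 * m \<le> n\<close> this gives
          \<open>m < q + s\<close>, so \<open>Z = {..<q}\<close> can be used with an empty
          \<open>B\<close>.\<close>
        have qbig: "n < q + m + s" using x0 Qmod[of x0] by auto
        show ?thesis
        proof (cases "card R \<le> 3 * ?e")
          case True
          have "?e \<le> card {..<q}" by (intro card_mono) auto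
          then have eq': "?e \<le> q" by simp
          have "card R * s * 2 \<le> (3 * ?e) * n"
            using True small mult_mono[of "card R" "3 * ?e" "2 * s" n] by (simp add: ac_simps)
          also have "\<dots> \<le> 4 * (n * q)"
          proof -
            have "3 * ?e \<le> 4 * q" using eq' by simp
            then show ?thesis using mult_le_mono1[of "3 * ?e" "4 * q" n] by (simp only: ac_simps)
          qed
          finally have "card R * s \<le> 2 * (n * q)" by (simp add: ac_simps)
          have c2: "card {q, n - s} \<le> 2" by (simp add: card_insert_if)
          then have "2 ^ card {q, n - s} * (card R * s) \<le> 2 ^ 2 * (card R * s)"
            by (intro mult_right_mono power_increasing) auto
          moreover have "2 ^ 2 * (card R * s) = 4 * (card R * s)" by simp
          ultimately have l: "2 ^ card {q, n - s} * (card R * s) \<le> 8 * (n * q)"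
            using \<open>card R * s \<le> 2 * (n * q)\<close> by linarith
          have "u < q \<and> q \<le> v" if "u < v" "(u \<in> {..<q}) \<noteq> (v \<in> {..<q})" for u v
            using that by auto
          then show ?thesis
            using q eq x0 m qbig c2 l
            by - (rule exI[of _ "{..<q}"], rule exI[of _ "{}"], rule exI[of _ "{q, n - s}"], auto)
        next
          case few: False
          have "\<not> R \<subseteq> {..<q}"
          proof
            assume "R \<subseteq> {..<q}"
            then have "R \<inter> {..<q} = R" by auto
            then show False using few by simp
          qed
          then obtain x where x: "x \<in> R" "x \<notin> Q" "q \<le> (x + m) mod n" "{q..(x + m) mod n} \<inter> R = {}"
            using nexthit by auto
          \<comment> \<open>A wrapped shift would land below \<open>m - s\<close>, hence below
            \<open>q\<close> by \<open>qbig\<close>, against \<open>unhit\<close>.\<close>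
          have Rlow: "y + m < n" if "y \<in> R" for y
          proof (rule ccontr)
            assume ge: "\<not> y + m < n"
            moreover have "y < n - s" using that R by auto
            ultimately have "(y + m) mod n = y + m - n"
              using m small by (simp add: mod_if)
            then show False using bspec[OF unhit that] \<open>y < n - s\<close> qbig m ge by linarith
          qed
          have xm: "{q..x + m} \<inter> R = {}" using x Rlow[of x] by simp
          \<comment> \<open>The part of \<open>R\<close> beyond the stretch. It lies above
            \<open>x + m\<close> because \<open>{q..x + m}\<close> misses \<open>R\<close>, and its
            shifts do not wrap, so it lies strictly between \<open>m\<close> and
            \<open>n - m\<close>. The bound \<open>ne\<close> on \<open>n - 2 * m\<close> then makes
            it dense in its hull.\<close>
          define F where "F = R - {..<q}"
          have Fhigh: "m < y" if "y \<in> F" for y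
          proof -
            have "y \<in> R" "q \<le> y" using that by (auto simp: F_def)
            then have "y \<notin> {q..x + m}" "q \<le> y" using xm by blast+
            then show ?thesis by simp
          qed
          have "F \<noteq> {}" using \<open>\<not> R \<subseteq> {..<q}\<close> by (auto simp: F_def)
          have FQ: "F \<subseteq> Q"
            using Rlow qbig by (auto simp: F_def Q_def)
          have cF: "card F + ?e = card R"
            using card_Int_Diff[OF finR, of "{..<q}"] by (simp add: F_def Int_commute)
          have "?a \<le> card R" using QR finR by (intro card_mono)
          have "2 * card R * (n - m) \<le> 2 * card R * (s + q)"
            using qbig by (intro mult_le_mono2) simp
          also have "\<dots> \<le> n * (card R + ?e)"
            using heavy \<open>?a \<le> card R\<close> by (meson add_mono le_refl mult_le_mono2 order_trans)
          finally have "card R * n \<le> 2 * (card R * m) + n * ?e"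
            using m by (simp add: algebra_simps diff_mult_distrib2)
          then have ne: "card R * (n - 2 * m) \<le> n * ?e"
            by (simp add: algebra_simps diff_mult_distrib2)
          show ?thesis
          proof (rule single[of F])
            fix u v assume "u \<in> F" "v \<in> F"
            then have "Suc v - u \<le> n - 2 * m" using Fhigh[of u] Rlow[of v] by (auto simp: F_def)
            then have "2 * card R * (Suc v - u) \<le> 2 * (card R * (n - 2 * m))" by simp
            also have "\<dots> \<le> n * (2 * ?e)" using ne by simp
            also have "\<dots> \<le> n * card F" using few cF by (intro mult_le_mono2) simp
            finally show "2 * card R * (Suc v - u) \<le> n * card F" .
          next
            have "card R \<le> 2 * card F" using few cF by simp
            then have "card R * (2 * s) \<le> (2 * card F) * n" using small by (intro mult_mono) auto
            then show "card R * s \<le> n * card F" by (simp add: ac_simps)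
          qed (use FQ \<open>F \<noteq> {}\<close> in auto)
        qed
      qed
    qed
  qed
qed

lemma sum_card_fibres:
  assumes "finite A" "finite J" "f ` A \<subseteq> J"
  shows "(\<Sum>w\<in>J. card {x \<in> A. f x = w}) = card A"
  using sum.group[OF assms, of "\<lambda>_. 1::nat"] by simp

text \<open>
  Position \<open>y\<close> belongs to path node \<open>b y\<close>, and \<open>S w\<close> consists of the vertices hanging off node \<open>w\<close>. In the proof,
  \<open>own y\<close> is the last hit hanging part at or before \<open>y\<close> on the cycle.
\<close>

lemma circle_separation:
  fixes n m :: nat and R :: "nat set" and b :: "nat \<Rightarrow> nat"
  assumes R: "R \<subseteq> {..<n}" "R \<noteq> {}" and m: "2 * m \<le> n"
    and b_mono: "\<forall>y z. y \<le> z \<and> z < n \<longrightarrow> b y \<le> b z"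
    and R_first: "\<forall>y z. y \<le> z \<and> z < n \<and> b y = b z \<and> y \<notin> R \<longrightarrow> z \<notin> R"
    and no_hit: "\<forall>x\<in>R. (x + m) mod n \<notin> R"
  defines "S \<equiv> \<lambda>w. {y. y < n \<and> y \<notin> R \<and> b y = w}"
  shows "\<exists>w Z B I. Z \<subseteq> {..<n} - S w \<and> B \<subseteq> {..<n} - S w \<and> Z \<inter> B = {} \<and> Z \<noteq> {} \<and>
     card B \<le> m \<and> m \<le> card B + card Z + card (S w) \<and>
     2 * card R * card Z \<le> n * card (R \<inter> Z) \<and>
     finite I \<and> I \<subseteq> b ` {..<n} \<and> card I \<le> 4 \<and> 2 ^ card I * (card R * card (S w)) \<le> 8 * (n * card Z) \<and>
     (\<forall>u v. u < v \<and> v < n \<and> ((u \<in> Z) \<noteq> (v \<in> Z) \<or> (u \<in> B) \<noteq> (v \<in> B) \<or> (u \<in> S w) \<noteq> (v \<in> S w)) \<longrightarrow>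
        (\<exists>i\<in>I. b u \<le> i \<and> i \<le> b v) \<and> \<not> (u \<notin> R \<and> v \<notin> R \<and> b u = b v))"
proof -
  have mono: "b y \<le> b z" if "y \<le> z" "z < n" for y z
    using b_mono that by blast
  have conv: "z \<notin> R" if "y \<le> z" "z < n" "b y = b z" "y \<notin> R" for y z
    using R_first that by blast
  have miss: "(x + m) mod n \<notin> R" if "x \<in> R" for x
    using no_hit that by blast
  have finR: "finite R" using R finite_subset by blast
  have n: "0 < n" using R by auto
  define f where "f x = b ((x + m) mod n)" for x
  define J where "J = f ` R"
  define H where "H = {y. y < n \<and> y \<notin> R \<and> b y \<in> J}"
  have fH: "(x + m) mod n \<in> H" if "x \<in> R" for x
    using that miss n by (auto simp: H_def J_def f_def)
  \<comment> \<open>Distance from \<open>y\<close> back to the nearest position in a hit part;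
    \<open>y + (n - d)\<close> is \<open>y - d\<close> on the cycle without truncated
    subtraction.\<close>
  define bk where "bk y = (LEAST d. (y + (n - d)) mod n \<in> H \<and> d < n)" for y
  define own where "own y = b ((y + (n - bk y)) mod n)" for y
  have bk: "(y + (n - bk y)) mod n \<in> H \<and> bk y < n" if "y < n" for y
  proof -
    obtain h where h: "h \<in> H" using fH R by auto
    then have hn: "h < n" by (auto simp: H_def)
    define d where "d = (y + (n - h)) mod n"
    have "(y + (n - d)) mod n = h \<and> d < n"
    proof (cases "h \<le> y")
      case True
      then have "d = y - h" using that by (simp add: d_def mod_if)
      then have "y + (n - d) = h + n" using True that by simp
      then show ?thesis using hn \<open>d = y - h\<close> that by simp
    next
      case False
      then have "d = y + (n - h)" using that by (simp add: d_def)
      then have "y + (n - d) = h" using False hn by simp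
      then show ?thesis using hn False \<open>d = y + (n - h)\<close> by simp
    qed
    then have "\<exists>d. (y + (n - d)) mod n \<in> H \<and> d < n" using h by blast
    then show ?thesis unfolding bk_def by (rule LeastI_ex)
  qed
  have bk_le: "bk y \<le> d" if "(y + (n - d)) mod n \<in> H" "d < n" for y d
    unfolding bk_def using that by (intro Least_le) simp
  have own: "own y \<in> J" if "y < n" for y
    using bk[OF that] by (auto simp: H_def own_def)
  have finJ: "finite J" using finR by (simp add: J_def)
  \<comment> \<open>Averaging: summed over \<open>J\<close>, both sides equal
    \<open>2 * card R * n\<close>, since each element of \<open>R\<close> hits one part and each
    position has one owner.\<close>
  have "\<exists>w\<in>J. 2 * card R * card {y \<in> {..<n}. own y = w} \<le> n * (card {x \<in> R. f x = w} + card {x \<in> R. own x = w})"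
  proof (rule ccontr)
    assume no: "\<not> ?thesis"
    have less: "n * (card {x \<in> R. f x = w} + card {x \<in> R. own x = w}) < 2 * card R * card {y \<in> {..<n}. own y = w}"
      if w: "w \<in> J" for w
    proof (rule ccontr)
      assume "\<not> ?thesis"
      then show False using no w by (auto simp only: not_less)
    qed
    have "(\<Sum>w\<in>J. n * (card {x \<in> R. f x = w} + card {x \<in> R. own x = w}))
      < (\<Sum>w\<in>J. 2 * card R * card {y \<in> {..<n}. own y = w})"
      using less finJ R(2) by (intro sum_strict_mono) (auto simp: J_def)
    moreover have "(\<Sum>w\<in>J. card {x \<in> R. f x = w}) = card R"
      using finR finJ by (intro sum_card_fibres) (auto simp: J_def)
    moreover have "(\<Sum>w\<in>J. card {x \<in> R. own x = w}) = card R"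
      using finR finJ own R by (intro sum_card_fibres) auto
    moreover have "(\<Sum>w\<in>J. card {y \<in> {..<n}. own y = w}) = card {..<n}"
      using finJ own by (intro sum_card_fibres) auto
    ultimately show False
      by (simp add: sum_distrib_left[symmetric] sum.distrib)
  qed
  then obtain w where w: "w \<in> J"
    and heavy: "2 * card R * card {y \<in> {..<n}. own y = w} \<le> n * (card {x \<in> R. f x = w} + card {x \<in> R. own x = w})"
    by blast
  have SH: "S w \<subseteq> H" using w by (auto simp: S_def H_def)
  obtain x0 where x0: "x0 \<in> R" "f x0 = w" using w by (auto simp: J_def)
  have x0S: "(x0 + m) mod n \<in> S w" using x0 miss n by (auto simp: S_def f_def)
  have finS: "finite (S w)" by (simp add: S_def)
  define a where "a = Min (S w)"
  define p where "p = Suc (Max (S w))"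
  have aS: "a \<in> S w" and pS: "p - 1 \<in> S w" using Min_in[OF finS] Max_in[OF finS] x0S
    by (auto simp: a_def p_def)
  \<comment> \<open>Within a block the elements of \<open>R\<close> come first, so the rest of the
    block is an interval.\<close>
  have Seq: "S w = {a..<p}"
  proof (intro equalityI subsetI)
    fix y assume "y \<in> S w"
    then show "y \<in> {a..<p}" using finS by (auto simp: a_def p_def less_Suc_eq_le)
  next
    fix y assume "y \<in> {a..<p}"
    then have y: "a \<le> y" "y \<le> p - 1" by auto
    have "p - 1 < n" using pS by (simp add: S_def)
    then have yn: "y < n" using y by simp
    have "b a \<le> b y" "b y \<le> b (p - 1)"
      using mono[OF y(1) yn] mono[OF y(2) \<open>p - 1 < n\<close>] by auto
    then have "b y = b a" "y < n" using aS pS yn by (auto simp: S_def)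
    then show "y \<in> S w" using aS y conv[of a y] by (auto simp: S_def)
  qed
  have ap: "a < p" using aS Seq by auto
  have pn: "p \<le> n" using pS ap by (auto simp: S_def)
  define s where "s = card (S w)"
  have s: "s = p - a" by (simp add: s_def Seq)
  \<comment> \<open>Rotation that starts right after \<open>S w\<close>, so that \<open>S w\<close>
    becomes \<open>{n - s..<n}\<close>; \<open>R'\<close> is \<open>R\<close> in the new
    coordinates.\<close>
  define \<rho> where "\<rho> y = (y + p) mod n" for y
  have rho_lt: "\<rho> y < n" for y using n by (simp add: \<rho>_def)
  have rho: "\<rho> y = (if y + p < n then y + p else y + p - n)" if "y < n" for y
    using that pn by (simp add: \<rho>_def mod_if)
  have inj: "inj_on \<rho> {..<n}"
    by (intro inj_onI) (auto simp: rho split: if_splits)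
  have surj: "\<exists>y<n. \<rho> y = z" if "z < n" for z
    using that pn by (intro exI[of _ "if p \<le> z then z - p else z + n - p"]) (auto simp: rho)
  have rho_shift: "\<rho> ((x + m) mod n) = (\<rho> x + m) mod n" for x
    by (simp add: \<rho>_def mod_simps ac_simps)
  have rho_S: "\<rho> y \<in> S w \<longleftrightarrow> n - s \<le> y" if "y < n" for y
    using that ap pn by (auto simp: Seq rho s split: if_splits)
  define R' where "R' = {y. y < n \<and> \<rho> y \<in> R}"
  have card_rho: "card {y. y < n \<and> \<rho> y \<in> A} = card A" if "A \<subseteq> {..<n}" for A
  proof -
    have "\<rho> ` {y. y < n \<and> \<rho> y \<in> A} = A" using that surj by (auto simp: image_iff)
    moreover have "inj_on \<rho> {y. y < n \<and> \<rho> y \<in> A}" by (rule inj_on_subset[OF inj]) auto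
    ultimately show ?thesis using card_image by metis
  qed
  have cardR': "card R' = card R" using card_rho[OF R(1)] by (simp add: R'_def)
  define q where "q = (LEAST y. y < n \<and> \<rho> y \<in> H)"
  have sn: "0 < s" "s \<le> n" using ap pn by (auto simp: s)
  have ns: "n - s < n \<and> \<rho> (n - s) \<in> H" using rho_S[of "n - s"] SH sn by auto
  then have qH: "q < n" "\<rho> q \<in> H"
    unfolding q_def using LeastI[of "\<lambda>y. y < n \<and> \<rho> y \<in> H"] by blast+
  have q_le: "q \<le> y" if "y < n" "\<rho> y \<in> H" for y
    unfolding q_def using that by (intro Least_le) simp
  have qns: "q \<le> n - s" using ns q_le by blast
  \<comment> \<open>The positions owned by \<open>w\<close> are \<open>S w\<close> and the stretch
    before the next hit part. From the stretch, the search back first meets \<open>p - 1\<close>,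
    the last element of \<open>S w\<close>, one step behind the new position
    \<open>0\<close>.\<close>
  have own_w: "own (\<rho> y) = w \<longleftrightarrow> y < q \<or> n - s \<le> y" if y: "y < n" for y
  proof -
    have step: "(\<rho> y + (n - d)) mod n = \<rho> (y - d)" if "d \<le> y" for d
    proof -
      have "(\<rho> y + (n - d)) mod n = (y + p + (n - d)) mod n" by (simp add: \<rho>_def mod_simps)
      also have "y + p + (n - d) = (y - d + p) + n" using that y by simp
      finally show ?thesis by (simp add: \<rho>_def)
    qed
    consider "y < q" | "n - s \<le> y" | "q \<le> y" "y < n - s" by linarith
    then show ?thesis
    proof cases
      case 1
      have far: "(\<rho> y + (n - Suc y)) mod n = p - 1"
      proof -
        have "(\<rho> y + (n - Suc y)) mod n = (y + p + (n - Suc y)) mod n" by (simp add: \<rho>_def mod_simps)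
        also have "y + p + (n - Suc y) = (p - 1) + n" using y ap by simp
        finally show ?thesis using pn ap by (simp only: mod_add_self2) simp
      qed
      have "\<not> bk (\<rho> y) \<le> y"
      proof
        assume le: "bk (\<rho> y) \<le> y"
        then have "\<rho> (y - bk (\<rho> y)) \<in> H" using bk[OF rho_lt] step by metis
        then have "q \<le> y - bk (\<rho> y)" using y by (intro q_le) auto
        then show False using 1 by linarith
      qed
      moreover have "bk (\<rho> y) \<le> Suc y"
      proof -
        have "Suc y < n" using 1 qH by simp
        then show ?thesis using far pS SH by (intro bk_le) auto
      qed
      ultimately have "bk (\<rho> y) = Suc y" by simp
      then have "own (\<rho> y) = b (p - 1)" using far by (simp add: own_def)
      then show ?thesis using pS 1 by (simp add: S_def)
    next
      case 2
      then have "\<rho> y \<in> S w" using rho_S y by simp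
      then have "bk (\<rho> y) \<le> 0" using SH rho_lt n by (intro bk_le) (auto simp: rho_lt)
      then have "own (\<rho> y) = b (\<rho> y)" using rho_lt by (simp add: own_def)
      then show ?thesis using \<open>\<rho> y \<in> S w\<close> 2 by (simp add: S_def)
    next
      case 3
      have "bk (\<rho> y) \<le> y - q"
        using step[of "y - q"] 3 qH y by (intro bk_le) auto
      then have le: "bk (\<rho> y) \<le> y" by simp
      have eq: "(\<rho> y + (n - bk (\<rho> y))) mod n = \<rho> (y - bk (\<rho> y))" using step[OF le] .
      have "\<rho> (y - bk (\<rho> y)) \<in> H" using bk[OF rho_lt, of y] eq by simp
      moreover have "\<rho> (y - bk (\<rho> y)) \<notin> S w" using rho_S[of "y - bk (\<rho> y)"] y 3 by auto
      ultimately have "b (\<rho> (y - bk (\<rho> y))) \<noteq> w" by (auto simp: H_def S_def)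
      then show ?thesis using 3 eq by (simp add: own_def)
    qed
  qed
  have R'low: "R' \<subseteq> {..<n - s}" using rho_S by (force simp: R'_def S_def)
  define Q where "Q = {x \<in> R'. n - s \<le> (x + m) mod n}"
  have Q_iff: "n - s \<le> (x + m) mod n \<longleftrightarrow> f (\<rho> x) = w" if "x \<in> R'" for x
  proof -
    have "n - s \<le> (x + m) mod n \<longleftrightarrow> (\<rho> x + m) mod n \<in> S w"
      using rho_S[of "(x + m) mod n"] n rho_shift by simp
    then show ?thesis using that miss n by (auto simp: R'_def S_def f_def)
  qed
  have cQ: "card Q = card {x \<in> R. f x = w}"
  proof -
    have "Q = {y. y < n \<and> \<rho> y \<in> {x \<in> R. f x = w}}" using Q_iff by (auto simp: Q_def R'_def)
    then show ?thesis using card_rho[of "{x \<in> R. f x = w}"] R by auto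
  qed
  have cE: "card (R' \<inter> {..<q}) = card {x \<in> R. own x = w}"
  proof -
    have "y \<in> R' \<inter> {..<q} \<longleftrightarrow> y < n \<and> \<rho> y \<in> {x \<in> R. own x = w}" for y
    proof -
      have "y < n - s" if "y < n" "\<rho> y \<in> R" using that R'low by (auto simp: R'_def)
      then show ?thesis using own_w[of y] by (auto simp: R'_def)
    qed
    then have "R' \<inter> {..<q} = {y. y < n \<and> \<rho> y \<in> {x \<in> R. own x = w}}" by blast
    then show ?thesis using card_rho[of "{x \<in> R. own x = w}"] R by auto
  qed
  have cD: "card {y \<in> {..<n}. own y = w} = s + q"
  proof -
    have "{y. y < n \<and> \<rho> y \<in> {y \<in> {..<n}. own y = w}} = {n - s..<n} \<union> {..<q}"
    proof -
      have "y < n \<and> \<rho> y \<in> {y \<in> {..<n}. own y = w} \<longleftrightarrow> y \<in> {n - s..<n} \<union> {..<q}" for y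
        using own_w[of y] rho_lt[of y] qH by auto
      then show ?thesis by blast
    qed
    moreover have "card ({n - s..<n} \<union> {..<q}) = s + q"
      using qns sn by (subst card_Un_disjoint) auto
    moreover have "card {y. y < n \<and> \<rho> y \<in> {y \<in> {..<n}. own y = w}} = card {y \<in> {..<n}. own y = w}"
      by (rule card_rho) auto
    ultimately show ?thesis by (simp only:)
  qed
  have unhit: "q \<le> (x + m) mod n" if "x \<in> R'" for x
    using that fH[of "\<rho> x"] n by (intro q_le) (auto simp: R'_def rho_shift)
  then have unhit': "\<forall>x\<in>R'. q \<le> (x + m) mod n" by blast
  \<comment> \<open>If the original numbering restarts between \<open>y\<close> and
    \<open>z\<close>, then \<open>\<rho> z \<le> p - 1 \<le> \<rho> y\<close>, and monotonicity of
    \<open>b\<close> forces the common node to be \<open>w\<close>.\<close>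
  have no_wrap: "\<rho> z = \<rho> y + (z - y)" if "y \<le> z" "z < n" "b (\<rho> y) = b (\<rho> z)" "b (\<rho> y) \<noteq> w" for y z
  proof (rule ccontr)
    assume "\<not> ?thesis"
    then have "\<rho> z \<le> p - 1" "p - 1 \<le> \<rho> y" using that ap pn by (auto simp: rho split: if_splits)
    then have "b (\<rho> z) \<le> b (p - 1)" "b (p - 1) \<le> b (\<rho> y)"
      using mono rho_lt pS by (auto simp: S_def)
    then show False using that pS by (auto simp: S_def)
  qed
  have nexthit: "R' \<subseteq> {..<q} \<or> (\<exists>x \<in> R' - Q. q \<le> (x + m) mod n \<and> {q..(x + m) mod n} \<inter> R' = {})"
  proof (cases "b (\<rho> q) = w")
    case True
    then have "\<rho> q \<in> S w" using qH by (auto simp: H_def S_def)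
    then have "q = n - s" using rho_S[of q] qH qns by simp
    then show ?thesis using R'low by simp
  next
    case False
    \<comment> \<open>The part containing \<open>\<rho> q\<close> is hit by some \<open>x\<close>.
      From \<open>q\<close> up to the shifted position everything lies in one block behind an
      element outside \<open>R\<close>, hence outside \<open>R\<close>.\<close>
    obtain x where x: "x \<in> R" "f x = b (\<rho> q)" using qH by (auto simp: H_def J_def)
    then obtain y where y: "y < n" "\<rho> y = x" using surj R by blast
    then have yR: "y \<in> R'" using x by (simp add: R'_def)
    have yQ: "y \<notin> Q" using Q_iff[OF yR] x y False by (auto simp: Q_def)
    let ?z = "(y + m) mod n"
    have bz: "b (\<rho> ?z) = b (\<rho> q)" using x y by (simp add: rho_shift f_def)
    have "z \<notin> R'" if "q \<le> z" "z \<le> ?z" for z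
    proof -
      have zn: "?z < n" using n by simp
      have e1: "\<rho> ?z = \<rho> q + (?z - q)" using unhit[OF yR] zn bz False by (intro no_wrap) auto
      have zn': "z < n" using that zn by linarith
      have "\<rho> z = \<rho> q + (z - q)"
      proof -
        obtain c where c: "c = ?z" by simp
        have *: "\<rho> c = \<rho> q + (c - q)" "c < n" "q \<le> z" "z \<le> c" using e1 zn that c by auto
        show ?thesis
          using rho[OF qH(1)] rho[OF zn'] rho[OF *(2)] * pn qH(1) zn' by (simp split: if_splits)
      qed
      then have le: "\<rho> q \<le> \<rho> z" "\<rho> z \<le> \<rho> ?z" using e1 that by auto
      then have "b (\<rho> q) \<le> b (\<rho> z)" "b (\<rho> z) \<le> b (\<rho> ?z)" using mono rho_lt by blast+
      then have "b (\<rho> q) = b (\<rho> z)" using bz by simp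
      then show ?thesis using conv[OF le(1) rho_lt] qH by (auto simp: H_def R'_def)
    qed
    then show ?thesis using yR yQ unhit by (intro disjI2 bexI[of _ y]) auto
  qed
  have heavy': "2 * card R' * (s + q) \<le> n * (card Q + card (R' \<inter> {..<q}))"
    using heavy by (simp only: cQ cE cD cardR')
  have R'ne: "R' \<noteq> {}" using cardR' R finR by (metis card.empty card_0_eq)
  have Qne: "Q \<noteq> {}"
  proof -
    obtain y where "y < n" "\<rho> y = x0" using surj x0 R by blast
    then have "y \<in> Q" using x0 Q_iff[of y] by (auto simp: Q_def R'_def)
    then show ?thesis by auto
  qed
  obtain Z B C where Z: "Z \<subseteq> {..<n - s}" and B: "B \<subseteq> {..<n - s}" and ZB: "Z \<inter> B = {}" "Z \<noteq> {}"
    "card B \<le> m" "m \<le> card B + card Z + s"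
    and dense: "2 * card R' * card Z \<le> n * card (R' \<inter> Z)"
    and C: "finite C" "C \<subseteq> R' \<union> {q, n - s}" "n - s \<in> C" "card C \<le> 4"
    "2 ^ card C * (card R' * s) \<le> 8 * (n * card Z)"
    and sep: "\<forall>u v. u < v \<and> v < n \<and> ((u \<in> Z) \<noteq> (v \<in> Z) \<or> (u \<in> B) \<noteq> (v \<in> B)) \<longrightarrow>
        (\<exists>z \<in> C \<inter> R'. u \<le> z \<and> z \<le> v) \<or> q \<in> C \<and> u < q \<and> q \<le> v \<or> u < n - s \<and> n - s \<le> v"
    using arc_separation[OF R'low R'ne sn m qns Qne[unfolded Q_def] unhit' nexthit[unfolded Q_def] heavy'[unfolded Q_def]]
    by (elim exE conjE)
  have Zn: "Z \<subseteq> {..<n}" and Bn: "B \<subseteq> {..<n}" using Z B by force+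
  have Cn: "C \<subseteq> {..<n}" using C(2) qH ns by (auto simp: R'_def)
  have card_im: "card (\<rho> ` A) = card A" if "A \<subseteq> {..<n}" for A
    by (rule card_image[OF inj_on_subset[OF inj that]])
  have in_im: "\<rho> y \<in> \<rho> ` A \<longleftrightarrow> y \<in> A" if "A \<subseteq> {..<n}" "y < n" for A y
    using inj_on_image_mem_iff[OF inj] that by auto
  define I where "I = (\<lambda>z. b (\<rho> z)) ` C"
  have cI: "card I \<le> card C" using C(1) by (simp add: I_def card_image_le)
  have wI: "w \<in> I"
    using C(3) rho_S[of "n - s"] ns unfolding I_def by (intro image_eqI[of _ _ "n - s"]) (auto simp: S_def)
  have main: "(\<exists>i\<in>I. b (\<rho> y) \<le> i \<and> i \<le> b (\<rho> z)) \<and> \<not> (\<rho> y \<notin> R \<and> \<rho> z \<notin> R \<and> b (\<rho> y) = b (\<rho> z))"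
    if yz: "y < n" "z < n" "\<rho> y < \<rho> z" and ne: "(y \<in> Z) \<noteq> (z \<in> Z) \<or> (y \<in> B) \<noteq> (z \<in> B) \<or> (n - s \<le> y) \<noteq> (n - s \<le> z)"
    for y z
  proof (cases "y < z")
    case True
    have mon: "\<rho> x = \<rho> y + (x - y)" if "y \<le> x" "x \<le> z" for x
      using that yz True pn by (auto simp: rho split: if_splits)
    have bmon: "b (\<rho> y) \<le> b (\<rho> x) \<and> b (\<rho> x) \<le> b (\<rho> z)" if "y \<le> x" "x \<le> z" for x
    proof -
      have "\<rho> y \<le> \<rho> x" "\<rho> x \<le> \<rho> z" using that mon[OF that] mon[of z] True by simp_all
      then show ?thesis using mono[OF _ rho_lt] by blast
    qed
    \<comment> \<open>Between two positions outside \<open>R\<close> in one block there are only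
      such positions, so none of the three kinds of cut in \<open>sep\<close> can fall
      there.\<close>
    have flat: "b (\<rho> x) = b (\<rho> y) \<and> \<rho> x \<notin> R"
      if "y \<le> x" "x \<le> z" "\<rho> y \<notin> R" "b (\<rho> y) = b (\<rho> z)" for x
    proof -
      have "\<rho> y \<le> \<rho> x" using mon[OF that(1,2)] by simp
      moreover have "b (\<rho> y) = b (\<rho> x)" using bmon[OF that(1,2)] that(4) by simp
      ultimately show ?thesis using conv[OF _ rho_lt] that(3) by auto
    qed
    have cases: "(\<exists>c \<in> C \<inter> R'. y \<le> c \<and> c \<le> z) \<or> q \<in> C \<and> y < q \<and> q \<le> z \<or> y < n - s \<and> n - s \<le> z"
    proof (cases "(n - s \<le> y) = (n - s \<le> z)")
      case True
      then show ?thesis using sep[rule_format, of y z] \<open>y < z\<close> yz(2) ne by blast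
    next
      case False
      then show ?thesis using \<open>y < z\<close> by linarith
    qed
    then obtain c where c: "c \<in> C" "y \<le> c" "c \<le> z" using C(3) by auto
    then have "\<exists>i\<in>I. b (\<rho> y) \<le> i \<and> i \<le> b (\<rho> z)" using bmon[of c] by (auto simp: I_def)
    moreover have False if fl: "\<rho> y \<notin> R" "b (\<rho> y) = b (\<rho> z)"
      using cases
    proof (elim disjE)
      assume "\<exists>c \<in> C \<inter> R'. y \<le> c \<and> c \<le> z"
      then show False using flat fl by (auto simp: R'_def)
    next
      assume q: "q \<in> C \<and> y < q \<and> q \<le> z"
      then have "b (\<rho> q) = b (\<rho> y)" using flat[of q] fl by auto
      then have "\<rho> y \<in> H" using qH fl rho_lt by (auto simp: H_def)
      then show False using q_le[OF yz(1)] q by simp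
    next
      assume *: "y < n - s \<and> n - s \<le> z"
      then have "b (\<rho> (n - s)) = b (\<rho> y)" using flat[of "n - s"] fl by auto
      then have "\<rho> y \<in> S w" using rho_S[of "n - s"] ns fl rho_lt by (auto simp: S_def)
      then show False using rho_S[OF yz(1)] * by simp
    qed
    ultimately show ?thesis by blast
  next
    \<comment> \<open>The rotation reverses the order of the pair, so the pair straddles the end of
      \<open>S w\<close>. Then \<open>w\<close> itself lies between the two nodes, and
      \<open>w\<close> is in \<open>I\<close> because \<open>n - s\<close> is in
      \<open>C\<close>.\<close>
    case False
    then have zy: "z < y" using yz by (cases "y = z") auto
    then have "\<rho> y \<le> p - 1" "p \<le> \<rho> z" using yz pn ap by (auto simp: rho split: if_splits)
    then have lw: "b (\<rho> y) \<le> w" "w \<le> b (\<rho> z)"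
      using mono[of "\<rho> y" "p - 1"] mono[of "p - 1" "\<rho> z"] pS rho_lt by (auto simp: S_def)
    moreover have False if fl: "\<rho> y \<notin> R" "\<rho> z \<notin> R" "b (\<rho> y) = b (\<rho> z)"
    proof -
      have "\<rho> z \<in> S w" using lw fl rho_lt by (auto simp: S_def)
      then show False using Seq \<open>p \<le> \<rho> z\<close> by auto
    qed
    ultimately show ?thesis using wI by blast
  qed
  show ?thesis
  proof (rule exI[of _ w], rule exI[of _ "\<rho> ` Z"], rule exI[of _ "\<rho> ` B"], rule exI[of _ I], intro conjI allI impI)
    show "\<rho> ` Z \<subseteq> {..<n} - S w" "\<rho> ` B \<subseteq> {..<n} - S w"
      using Z B Zn Bn rho_S rho_lt by force+
    show "\<rho> ` Z \<inter> \<rho> ` B = {}" using ZB inj_on_image_Int[OF inj Zn Bn] by simp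
    show "\<rho> ` Z \<noteq> {}" using ZB by simp
    show "card (\<rho> ` B) \<le> m" using ZB card_im[OF Bn] by simp
    show "m \<le> card (\<rho> ` B) + card (\<rho> ` Z) + card (S w)" using ZB card_im[OF Bn] card_im[OF Zn] by (simp add: s_def)
    have "\<rho> ` (R' \<inter> Z) = R \<inter> \<rho> ` Z" using Zn by (auto simp: R'_def)
    moreover have "card (\<rho> ` (R' \<inter> Z)) = card (R' \<inter> Z)" using Zn by (intro card_im) auto
    ultimately show "2 * card R * card (\<rho> ` Z) \<le> n * card (R \<inter> \<rho> ` Z)"
      using dense card_im[OF Zn] cardR' by simp
    show "finite I" "I \<subseteq> b ` {..<n}" "card I \<le> 4" using C cI rho_lt by (auto simp: I_def)
    have "2 ^ card I * (card R * card (S w)) \<le> 2 ^ card C * (card R * card (S w))"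
      using cI by (intro mult_right_mono power_increasing) auto
    then show "2 ^ card I * (card R * card (S w)) \<le> 8 * (n * card (\<rho> ` Z))"
      using C(5) by (simp only: card_im[OF Zn] cardR' s_def)
    fix u v
    assume uv: "u < v \<and> v < n \<and> ((u \<in> \<rho> ` Z) \<noteq> (v \<in> \<rho> ` Z) \<or> (u \<in> \<rho> ` B) \<noteq> (v \<in> \<rho> ` B) \<or> (u \<in> S w) \<noteq> (v \<in> S w))"
    then obtain y z where yz: "y < n" "\<rho> y = u" "z < n" "\<rho> z = v"
      using surj by (metis order_less_trans)
    have "(y \<in> Z) \<noteq> (z \<in> Z) \<or> (y \<in> B) \<noteq> (z \<in> B) \<or> (n - s \<le> y) \<noteq> (n - s \<le> z)"
      using uv yz in_im[OF Zn] in_im[OF Bn] rho_S by blast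
    then show "(\<exists>i\<in>I. b u \<le> i \<and> i \<le> b v)" "\<not> (u \<notin> R \<and> v \<notin> R \<and> b u = b v)"
      using main[of y z] yz uv by auto
  qed
qed

section \<open>Rooted tree decompositions\<close>

text \<open>
  Trees are rooted at node \<open>0\<close> and given by a parent function with \<open>par j < j\<close>; the test \<open>j \<le> par j\<close> only ensures
  termination. \<open>branch par h j\<close> is the child of \<open>h\<close> above \<open>j\<close>, or \<open>h\<close> if \<open>j\<close> is not a proper
  descendant of \<open>h\<close>; \<open>gate par k j\<close> is the node at which \<open>j\<close> hangs off the path \<open>0, \<dots>, k - 1\<close>.
\<close>

fun branch :: "(nat \<Rightarrow> nat) \<Rightarrow> nat \<Rightarrow> nat \<Rightarrow> nat" where
  "branch par h j = (if j \<le> h \<or> j \<le> par j then h else if par j = h then j else branch par h (par j))"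

fun gate :: "(nat \<Rightarrow> nat) \<Rightarrow> nat \<Rightarrow> nat \<Rightarrow> nat" where
  "gate par k j = (if j < k \<or> j \<le> par j then j else gate par k (par j))"

declare branch.simps [simp del] gate.simps [simp del]

text \<open>The index \<open>i\<close> is the first to overshoot \<open>j\<close> when terms are
  added one by one. For component sizes, \<open>J\<close> collects the components taken whole and
  \<open>i\<close> is the one to be split.\<close>

lemma greedy_fill:
  fixes c :: "'i \<Rightarrow> nat"
  assumes "finite I" "j < sum c I"
  shows "\<exists>J i. J \<subseteq> I \<and> i \<in> I \<and> i \<notin> J \<and> sum c J \<le> j \<and> j < sum c J + c i"
  using assms
proof (induction I rule: finite_induct)
  case (insert x I)
  show ?case
  proof (cases "j < sum c I")
    case True
    then show ?thesis using insert.IH by blast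
  next
    case False
    then show ?thesis using insert.prems insert.hyps
      by (intro exI[of _ I] exI[of _ x]) (auto simp: not_less)
  qed
qed simp

lemma halving_exponent:
  fixes r s n z c :: nat
  assumes "0 < r" "r \<le> n" "0 < z" "c \<le> 4" and le: "2 ^ c * (r * s) \<le> 8 * (n * z)"
  shows "\<exists>K::nat. s \<le> 2 ^ K * z \<and> real (c + K) \<le> log 2 (real n / real r) + 4"
proof (cases "s \<le> z")
  case True
  have "0 \<le> log 2 (real n / real r)" using assms by simp
  then show ?thesis using True assms(4) by (intro exI[of _ 0]) auto
next
  case False
  define x where "x = log 2 (real s / real z)"
  have x: "0 < x" using False assms unfolding x_def by (subst zero_less_log_cancel_iff) auto
  define K where "K = nat \<lceil>x\<rceil>"
  have K: "x \<le> real K" "real K \<le> x + 1" using x by (auto simp: K_def)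
  have "real s / real z = 2 powr x" using False assms by (simp add: x_def)
  also have "\<dots> \<le> 2 powr real K" using K by simp
  finally have "real s \<le> 2 ^ K * real z" using assms by (simp add: powr_realpow field_simps)
  then have "real s \<le> real (2 ^ K * z)" by simp
  then have sK: "s \<le> 2 ^ K * z" by (simp only: of_nat_le_iff)
  have "real (2 ^ c * (r * s)) \<le> real (8 * (n * z))" using le by (simp only: of_nat_le_iff)
  then have "real s / real z * 2 ^ c \<le> 8 * (real n / real r)" using assms by (simp add: field_simps)
  then have "log 2 (real s / real z * 2 ^ c) \<le> log 2 (8 * (real n / real r))"
    using False assms by (subst log_le_cancel_iff) auto
  moreover have "log 2 (real s / real z * 2 ^ c) = x + real c"
  proof -
    have "log 2 (real s / real z * 2 ^ c) = log 2 (real s / real z) + log 2 (2 ^ c)"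
      using False assms by (intro log_mult_pos) auto
    then show ?thesis by (simp add: x_def)
  qed
  moreover have "log 2 (8 * (real n / real r)) = 3 + log 2 (real n / real r)"
  proof -
    have "log 2 (8::real) = 3" using log_pow_cancel[of "2::real" 3] by simp
    moreover have "log 2 (8 * (real n / real r)) = log 2 8 + log 2 (real n / real r)"
      using assms by (intro log_mult_pos) auto
    ultimately show ?thesis by simp
  qed
  ultimately show ?thesis using sK K by (intro exI[of _ K]) auto
qed

text \<open>\<open>conn\<close> expresses without paths that the nodes whose bags contain
  \<open>v\<close> are connected: any predicate separating two of them changes along a parent edge
  with \<open>v\<close> in both bags. The nodes below \<open>k\<close> form the chosen path.\<close>

locale rooted_decomposition =
  fixes N k :: nat and par :: "nat \<Rightarrow> nat" and Y :: "nat \<Rightarrow> 'a set"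
    and V :: "'a set" and E :: "'a set set" and t D :: nat
  assumes finV: "finite V" and finE: "finite E"
    and par_less: "\<And>j. 0 < j \<Longrightarrow> par j < j"
    and cover: "\<And>v. v \<in> V \<Longrightarrow> \<exists>j<N. v \<in> Y j"
    and edge: "\<And>e. e \<in> E \<Longrightarrow> \<exists>j<N. e \<subseteq> Y j"
    and conn: "\<And>v P i j. v \<in> V \<Longrightarrow> i < N \<Longrightarrow> j < N \<Longrightarrow> v \<in> Y i \<Longrightarrow> v \<in> Y j \<Longrightarrow> P i \<Longrightarrow> \<not> P j \<Longrightarrow>
      \<exists>h. 0 < h \<and> h < N \<and> v \<in> Y h \<and> v \<in> Y (par h) \<and> P h \<noteq> P (par h)"
    and bag: "\<And>j. j < N \<Longrightarrow> card (Y j) \<le> t" and finY: "\<And>j. j < N \<Longrightarrow> finite (Y j)"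
    and degree: "\<And>v. card {e \<in> E. v \<in> e} \<le> D"
    and k: "0 < k" "k \<le> N" and spine: "\<And>i. Suc i < k \<Longrightarrow> par (Suc i) = i"
begin

definition R where "R = (\<Union>i<k. Y i)"

definition cross where "cross U B = {e \<in> E. e \<subseteq> U \<and> e \<inter> B \<noteq> {} \<and> \<not> e \<subseteq> B}"

definition touch where "touch A = {e \<in> E. e \<inter> A \<noteq> {}}"

section \<open>Number of edges meeting a union of bags\<close>

lemma card_touch: "finite A \<Longrightarrow> card (touch A) \<le> card A * D"
proof -
  assume "finite A"
  have eq: "touch A = (\<Union>v\<in>A. {e \<in> E. v \<in> e})" by (auto simp: touch_def)
  have "card (touch A) \<le> (\<Sum>v\<in>A. card {e \<in> E. v \<in> e})"
    unfolding eq by (rule card_UN_le[OF \<open>finite A\<close>])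
  also have "\<dots> \<le> (\<Sum>v\<in>A. D)" by (intro sum_mono degree)
  finally show ?thesis by simp
qed

lemma card_touch_bags:
  assumes "finite I" "I \<subseteq> {..<N}"
  shows "card (touch (\<Union>i\<in>I. Y i)) \<le> card I * t * D"
proof -
  have "card (\<Union>i\<in>I. Y i) \<le> (\<Sum>i\<in>I. card (Y i))" by (rule card_UN_le[OF assms(1)])
  also have "\<dots> \<le> (\<Sum>i\<in>I. t)" using assms by (intro sum_mono bag) auto
  finally have "card (\<Union>i\<in>I. Y i) * D \<le> card I * t * D" by simp
  moreover have "finite (\<Union>i\<in>I. Y i)" using assms finY by auto
  ultimately show ?thesis by (intro order_trans[OF card_touch])
qed

lemma card_touch_bag: "j < N \<Longrightarrow> card (touch (Y j)) \<le> t * D"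
  using card_touch_bags[of "{j}"] by simp

section \<open>Subtrees, centroid bags and approximate cuts\<close>

lemma branch_par:
  assumes "0 < j" "j \<noteq> h" "par j \<noteq> h"
  shows "branch par h j = branch par h (par j)"
proof (cases "j < h")
  case True
  then have "par j < h" using par_less[OF assms(1)] by simp
  then show ?thesis using True by (simp add: branch.simps)
next
  case False
  then have "h < j" using assms(2) by simp
  then show ?thesis using assms par_less[OF assms(1)] by (subst branch.simps) simp
qed

text \<open>\<open>branch par h\<close> changes only along tree edges at \<open>h\<close>. The bags
  of \<open>v\<close> are connected and avoid \<open>h\<close>, so they lie in one component of the
  tree without \<open>h\<close>.\<close>

lemma branch_const:
  assumes "v \<in> V" "v \<notin> Y h" "i < N" "j < N" "v \<in> Y i" "v \<in> Y j"
  shows "branch par h i = branch par h j"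
proof (rule ccontr)
  assume "\<not> ?thesis"
  then obtain l where l: "0 < l" "l < N" "v \<in> Y l" "v \<in> Y (par l)"
    "(branch par h l = branch par h i) \<noteq> (branch par h (par l) = branch par h i)"
    using conn[of v i j "\<lambda>x. branch par h x = branch par h i"] assms by metis
  then have "l \<noteq> h" "par l \<noteq> h" using assms by auto
  then show False using l branch_par[of l h] by simp
qed

text \<open>Membership of \<open>j\<close> in the subtree rooted at \<open>h\<close>. Since
  \<open>branch\<close> returns \<open>h\<close> both for \<open>h\<close> itself and for nodes
  outside the subtree, the case \<open>j = h\<close> is listed separately.\<close>

definition below where "below h j \<longleftrightarrow> j = h \<or> branch par h j \<noteq> h"

text \<open>Each component of the tree without \<open>h\<close>, except the one towards the root,
  lies in the subtree of a node with a number larger than \<open>h\<close>; this drives the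
  maximality argument in \<open>centroid\<close>.\<close>

lemma below_branch: "branch par h j \<noteq> h \<Longrightarrow> below (branch par h j) j \<and> h < branch par h j \<and> branch par h j \<le> j"
proof (induction j rule: less_induct)
  case (less j)
  have hj: "h < j" using less.prems by (subst (asm) branch.simps) (auto split: if_splits)
  then have pj: "par j < j" using par_less by simp
  show ?case
  proof (cases "par j = h")
    case True
    then have "branch par h j = j" using hj pj by (subst branch.simps) auto
    then show ?thesis using hj by (simp add: below_def)
  next
    case False
    then have eq: "branch par h j = branch par h (par j)" using hj pj by (subst branch.simps) auto
    define c where "c = branch par h (par j)"
    have IH: "below c (par j)" "h < c" "c \<le> par j" using less.IH[OF pj] less.prems eq by (auto simp: c_def)
    have "branch par c j \<noteq> c"
    proof (cases "par j = c")
      case True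
      then show ?thesis using IH pj by (subst branch.simps) auto
    next
      case False
      then have "branch par c (par j) \<noteq> c" using IH by (auto simp: below_def)
      then show ?thesis using False IH pj by (subst branch.simps) auto
    qed
    then show ?thesis using IH eq pj by (simp add: below_def c_def)
  qed
qed

lemma below_root: "below 0 j"
proof (induction j rule: less_induct)
  case (less j)
  show ?case
  proof (cases "j = 0")
    case False
    then have pj: "par j < j" using par_less by simp
    show ?thesis
    proof (cases "par j = 0")
      case True
      then show ?thesis using False pj unfolding below_def by (subst branch.simps) auto
    next
      case False
      then have "branch par 0 (par j) \<noteq> 0" using less.IH[OF pj] by (simp add: below_def)
      then show ?thesis using False pj unfolding below_def by (subst branch.simps) auto
    qed
  qed (simp add: below_def)
qed

text \<open>Assign one bag to each vertex and take the largest-numbered \<open>h\<close> whose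
  subtree receives more than half of \<open>S\<close>. Less than half remains outside, and the
  branches below \<open>h\<close> have larger numbers, so none receives more than half.
  \<open>g\<close> labels the components of the tree without \<open>h\<close>.\<close>

lemma centroid:
  assumes S: "S \<subseteq> V" "S \<noteq> {}"
  shows "\<exists>h<N. \<exists>g :: 'a \<Rightarrow> nat. (\<forall>i. 2 * card {v \<in> S - Y h. g v = i} \<le> card S) \<and>
    (\<forall>e\<in>E. e \<subseteq> S \<longrightarrow> e \<inter> Y h = {} \<longrightarrow> (\<forall>u\<in>e. \<forall>v\<in>e. g u = g v))"
proof -
  have finS: "finite S" using S finV finite_subset by blast
  define \<beta> where "\<beta> v = (SOME j. j < N \<and> v \<in> Y j)" for v
  have \<beta>: "\<beta> v < N \<and> v \<in> Y (\<beta> v)" if "v \<in> S" for v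
  proof -
    have "\<exists>j. j < N \<and> v \<in> Y j" using cover[of v] S that by auto
    then show ?thesis unfolding \<beta>_def by (rule someI_ex)
  qed
  define wt where "wt h = card {v \<in> S. below h (\<beta> v)}" for h
  define P where "P h \<longleftrightarrow> h < N \<and> card S < 2 * wt h" for h
  have "wt 0 = card S" by (simp add: wt_def below_root)
  moreover have "0 < card S" using S finS by (simp add: card_gt_0_iff)
  ultimately have "P 0" using k by (simp add: P_def)
  moreover have "\<forall>h. P h \<longrightarrow> h \<le> N" by (simp add: P_def)
  ultimately obtain h where h: "P h" "\<And>i. P i \<Longrightarrow> i \<le> h"
    using Greatest_le_nat[of P _ N] GreatestI_nat[of P 0 N] by blast
  define g where "g v = branch par h (\<beta> v)" for v
  have "h < N" using h by (simp add: P_def)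
  then show ?thesis
  proof (intro exI[of _ h] exI[of _ g] conjI allI ballI impI)
    fix i
    show "2 * card {v \<in> S - Y h. g v = i} \<le> card S"
    proof (cases "i = h")
      case True
      have "\<not> below h (\<beta> v)" if "v \<in> S - Y h" "g v = i" for v
        using that \<beta>[of v] True by (auto simp: below_def g_def)
      then have "card {v \<in> S - Y h. g v = i} \<le> card (S - {v \<in> S. below h (\<beta> v)})"
        using finS by (intro card_mono) auto
      also have "\<dots> = card S - wt h" using finS by (simp add: wt_def card_Diff_subset)
      finally show ?thesis using h(1) by (auto simp: P_def)
    next
      case False
      have bl: "below i (\<beta> v) \<and> h < i \<and> i < N" if "v \<in> S" "g v = i" for v
        using below_branch[of h "\<beta> v"] that False \<beta>[of v] by (auto simp: g_def)
      show ?thesis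
      proof (cases "{v \<in> S - Y h. g v = i} = {}")
        case False
        then have "h < i" "i < N" using bl by auto
        then have "2 * wt i \<le> card S" using h(2)[of i] by (auto simp: P_def not_less[symmetric])
        moreover have "card {v \<in> S - Y h. g v = i} \<le> wt i"
          unfolding wt_def using finS bl by (intro card_mono) auto
        ultimately show ?thesis by simp
      qed (simp only: card.empty)
    qed
  next
    fix e u v assume e: "e \<in> E" "e \<subseteq> S" "e \<inter> Y h = {}" "u \<in> e" "v \<in> e"
    then obtain j where j: "j < N" "e \<subseteq> Y j" using edge by blast
    have "g x = branch par h j" if "x \<in> e" for x
      unfolding g_def using that e S j \<beta>[of x] by (intro branch_const[of x]) auto
    then show "g u = g v" using e by simp
  qed
qed

text \<open>Each level of the recursion spends one bag and halves the set in which the target size is still missed.\<close>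

lemma approximate_cut:
  assumes "S \<subseteq> V" "j \<le> card S"
  shows "\<exists>B \<subseteq> S. card B \<le> j \<and> (j - card B) * 2 ^ K \<le> card S \<and> card (cross S B) \<le> K * t * D"
  using assms
proof (induction K arbitrary: S j)
  case 0
  then show ?case by (intro exI[of _ "{}"]) (simp add: cross_def)
next
  case (Suc K)
  have finS: "finite S" using Suc.prems finV finite_subset by blast
  show ?case
  proof (cases "S = {}")
    case True
    then show ?thesis using Suc.prems by (intro exI[of _ "{}"]) (simp add: cross_def)
  next
    case False
    obtain h and g :: "'a \<Rightarrow> nat" where h: "h < N"
      and half: "\<forall>i. 2 * card {v \<in> S - Y h. g v = i} \<le> card S"
      and mono: "\<forall>e\<in>E. e \<subseteq> S \<longrightarrow> e \<inter> Y h = {} \<longrightarrow> (\<forall>u\<in>e. \<forall>v\<in>e. g u = g v)"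
      using centroid[OF Suc.prems(1) False] by (elim exE conjE)
    let ?S = "S - Y h" and ?p = "\<lambda>i. {v \<in> S - Y h. g v = i}"
    have ftouch: "finite (touch (Y h))" using finE by (simp add: touch_def)
    show ?thesis
    proof (cases "card ?S \<le> j")
      case True
      \<comment> \<open>All of \<open>S\<close> outside the bag fits and is topped up from the bag
        to exactly \<open>j\<close>; only edges meeting the bag are cut.\<close>
      have "card (S \<inter> Y h) = card S - card ?S" using finS
        by (metis Diff_Diff_Int card_Diff_subset Diff_subset finite_Diff)
      then have "j - card ?S \<le> card (S \<inter> Y h)" using Suc.prems by simp
      then obtain A where A: "A \<subseteq> S \<inter> Y h" "card A = j - card ?S"
        using obtain_subset_with_card_n by metis
      have "finite A" using A finS finite_subset by blast
      then have c: "card (?S \<union> A) = j" using A True finS by (subst card_Un_disjoint) auto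
      have "cross S (?S \<union> A) \<subseteq> touch (Y h)" by (auto simp: cross_def touch_def)
      then have "card (cross S (?S \<union> A)) \<le> t * D"
        using card_mono[OF ftouch] card_touch_bag[OF h] order_trans by blast
      then show ?thesis using A c
        by (intro exI[of _ "?S \<union> A"]) (auto simp: algebra_simps)
    next
      case False
      define I where "I = g ` ?S"
      have finI: "finite I" using finS by (simp add: I_def)
      have sumJ: "(\<Sum>i\<in>J. card (?p i)) = card {v \<in> ?S. g v \<in> J}" if "finite J" for J
      proof -
        have "(\<Sum>i\<in>J. card (?p i)) = (\<Sum>i\<in>J. card {v \<in> {v \<in> ?S. g v \<in> J}. g v = i})"
          by (intro sum.cong refl arg_cong[where f = card]) auto
        also have "\<dots> = card {v \<in> ?S. g v \<in> J}" using finS that by (intro sum_card_fibres) auto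
        finally show ?thesis .
      qed
      have "{v \<in> ?S. g v \<in> I} = ?S" by (auto simp: I_def)
      then have "j < (\<Sum>i\<in>I. card (?p i))" using sumJ[OF finI] False by simp
      from greedy_fill[OF finI this] obtain J i where J: "J \<subseteq> I" "i \<in> I" "i \<notin> J" "(\<Sum>i\<in>J. card (?p i)) \<le> j"
        "j < (\<Sum>i\<in>J. card (?p i)) + card (?p i)"
        by (elim exE conjE)
      \<comment> \<open>The components taken whole. The remaining demand \<open>j - card A\<close>
        is met inside component \<open>i\<close>, which holds at most half of
        \<open>S\<close>.\<close>
      define A where "A = {v \<in> ?S. g v \<in> J}"
      have finJ: "finite J" using J finI finite_subset by blast
      have cA: "card A \<le> j" "j < card A + card (?p i)" using J sumJ[OF finJ] by (auto simp: A_def)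
      obtain B where B: "B \<subseteq> ?p i" "card B \<le> j - card A" "(j - card A - card B) * 2 ^ K \<le> card (?p i)"
        "card (cross (?p i) B) \<le> K * t * D"
      proof -
        have "?p i \<subseteq> V" "j - card A \<le> card (?p i)" using Suc.prems(1) cA by auto
        from Suc.IH[OF this] show thesis using that by blast
      qed
      have finB: "finite B" by (rule finite_subset[of _ S]) (use B(1) finS in auto)
      have disj: "A \<inter> B = {}" using B(1) J(3) by (auto simp: A_def)
      have cAB: "card (A \<union> B) = card A + card B"
        using disj finB finS by (intro card_Un_disjoint) (auto simp: A_def)
      have "cross S (A \<union> B) \<subseteq> touch (Y h) \<union> cross (?p i) B"
      proof
        fix e assume e: "e \<in> cross S (A \<union> B)"
        show "e \<in> touch (Y h) \<union> cross (?p i) B"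
        proof (cases "e \<inter> Y h = {}")
          case True
          from e have eS: "e \<in> E" "e \<subseteq> S" "\<not> e \<subseteq> A \<union> B" by (auto simp: cross_def)
          obtain u where u: "u \<in> e" "u \<in> A \<union> B" using e by (auto simp: cross_def)
          have gu: "g v = g u" if "v \<in> e" for v using mono eS True that u(1) by blast
          have "g u = i"
          proof (rule ccontr)
            assume "g u \<noteq> i"
            then have "g u \<in> J" using u(2) B(1) by (auto simp: A_def)
            then have "e \<subseteq> A" using gu eS True by (auto simp: A_def)
            then show False using eS by auto
          qed
          then have "e \<subseteq> ?p i" using gu eS True by auto
          moreover have "u \<in> B" using u \<open>g u = i\<close> J(3) by (auto simp: A_def)
          ultimately show ?thesis using eS u(1) by (auto simp: cross_def)
        qed (use e in \<open>auto simp: cross_def touch_def\<close>)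
      qed
      then have "card (cross S (A \<union> B)) \<le> card (touch (Y h) \<union> cross (?p i) B)"
        using ftouch finE by (intro card_mono) (auto simp: cross_def)
      also have "\<dots> \<le> card (touch (Y h)) + card (cross (?p i) B)" by (rule card_Un_le)
      also have "\<dots> \<le> t * D + K * t * D" using card_touch_bag[OF h] B(4) by simp
      finally have cost: "card (cross S (A \<union> B)) \<le> Suc K * t * D" by (simp add: algebra_simps)
      have "(j - card (A \<union> B)) * 2 ^ Suc K = 2 * ((j - card A - card B) * 2 ^ K)" by (simp add: cAB)
      also have "\<dots> \<le> 2 * card (?p i)" using B(3) by simp
      also have "\<dots> \<le> card S" using half by blast
      finally have "(j - card (A \<union> B)) * 2 ^ Suc K \<le> card S" .
      moreover have "A \<union> B \<subseteq> S" using B(1) by (auto simp: A_def)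
      moreover have "card (A \<union> B) \<le> j" using cAB B(2) cA by simp
      ultimately show ?thesis using cost by blast
    qed
  qed
qed

section \<open>Position of vertices and edges along the path\<close>

lemma gate_less: "gate par k j < k"
proof (induction j rule: less_induct)
  case (less j)
  show ?case
  proof (cases "j < k")
    case False
    then have "par j < j" using k par_less by simp
    then show ?thesis using less.IH[of "par j"] False by (subst gate.simps) simp
  qed (simp add: gate.simps)
qed

lemma gate_spine: "j < k \<Longrightarrow> gate par k j = j"
  by (simp add: gate.simps)

lemma gate_par:
  assumes "0 < h" "gate par k h \<noteq> gate par k (par h)"
  shows "h < k" "par h = h - 1"
proof -
  show "h < k"
  proof (rule ccontr)
    assume "\<not> h < k"
    then have "gate par k h = gate par k (par h)"
      using par_less[OF assms(1)] by (subst gate.simps) simp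
    then show False using assms by simp
  qed
  then show "par h = h - 1" using spine[of "h - 1"] assms(1) by simp
qed

text \<open>The gate changes only along path edges, and there by one. A threshold at
  \<open>l\<close> separating two bags of \<open>v\<close> is therefore crossed at a path edge
  ending in \<open>l\<close>, with \<open>v\<close> in both bags. At the upper end the threshold has
  to be strict.\<close>

lemma spine_bag:
  assumes v: "v \<in> V" "i < N" "j < N" "v \<in> Y i" "v \<in> Y j"
    and l: "gate par k i \<le> l" "l \<le> gate par k j" "gate par k i < gate par k j"
  shows "v \<in> Y l"
proof (cases "l < gate par k j")
  case True
  then obtain h where h: "0 < h" "h < N" "v \<in> Y h" "v \<in> Y (par h)"
    "(gate par k h \<le> l) \<noteq> (gate par k (par h) \<le> l)"
    using conn[OF v, of "\<lambda>x. gate par k x \<le> l"] l by auto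
  then have hk: "h < k" "par h = h - 1" using gate_par[of h] by auto
  then have "gate par k h = h" "gate par k (par h) = h - 1" using gate_spine by auto
  then have "l = par h" using h hk by auto
  then show ?thesis using h by simp
next
  case False
  then have lj: "l = gate par k j" using l by simp
  then obtain h where h: "0 < h" "h < N" "v \<in> Y h" "v \<in> Y (par h)"
    "(gate par k h < l) \<noteq> (gate par k (par h) < l)"
    using conn[OF v, of "\<lambda>x. gate par k x < l"] l by auto
  then have hk: "h < k" "par h = h - 1" using gate_par[of h] by auto
  then have "gate par k h = h" "gate par k (par h) = h - 1" using gate_spine by auto
  then have "l = h" using h hk by auto
  then show ?thesis using h by simp
qed

text \<open>For \<open>v\<close> in \<open>R\<close> this is the first path node whose bag contains
  \<open>v\<close>; otherwise all bags of \<open>v\<close> hang off one path node, and it is that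
  node.\<close>

definition block where "block v = (LEAST c. \<exists>j<N. v \<in> Y j \<and> gate par k j = c)"

lemma block_attained:
  assumes "v \<in> V"
  obtains j where "j < N" "v \<in> Y j" "gate par k j = block v"
proof -
  have "\<exists>c. \<exists>j<N. v \<in> Y j \<and> gate par k j = c" using cover[OF assms] by blast
  then have "\<exists>j<N. v \<in> Y j \<and> gate par k j = block v" unfolding block_def by (rule LeastI_ex)
  then show thesis using that by blast
qed

lemma block_le: "j < N \<Longrightarrow> v \<in> Y j \<Longrightarrow> block v \<le> gate par k j"
  unfolding block_def by (rule Least_le) blast

lemma block_less: "v \<in> V \<Longrightarrow> block v < k"
  using block_attained gate_less by metis

lemma R_block:
  assumes "v \<in> V" "v \<in> R"
  shows "v \<in> Y (block v)"
proof -
  obtain i where i: "i < k" "v \<in> Y i" using assms by (auto simp: R_def)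
  then have le: "block v \<le> i" using block_le[of i v] gate_spine[of i] k by simp
  obtain j where j: "j < N" "v \<in> Y j" "gate par k j = block v" using block_attained assms by blast
  show ?thesis
  proof (cases "block v = i")
    case False
    then show ?thesis using spine_bag[of v j i "block v"] assms i j le gate_spine[of i] k by auto
  qed (use i in simp)
qed

text \<open>If the blocks differ, a bag containing the edge has gate at least
  \<open>block v\<close>, so the bags of \<open>u\<close> reach from \<open>block u\<close> past
  \<open>l\<close>. If they agree, an end in \<open>R\<close> lies in the bag of its own
  block.\<close>

lemma edge_meets_bag:
  assumes e: "e \<in> E" "e \<subseteq> V" "u \<in> e" "v \<in> e"
    and l: "block u \<le> l" "l \<le> block v" and ne: "\<not> (u \<notin> R \<and> v \<notin> R \<and> block u = block v)"
  shows "e \<inter> Y l \<noteq> {}"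
proof (cases "block u < block v")
  case True
  obtain j where j: "j < N" "e \<subseteq> Y j" using edge e by blast
  obtain i where i: "i < N" "u \<in> Y i" "gate par k i = block u" using block_attained e by blast
  have "block v \<le> gate par k j" using block_le[of j v] j e by auto
  then have "u \<in> Y l" using spine_bag[of u i j l] True i j e l by auto
  then show ?thesis using e by auto
next
  case False
  then have "l = block u" "l = block v" using l by auto
  then show ?thesis using R_block[of u] R_block[of v] ne e by auto
qed

section \<open>Splitting off a part in which the density of \<open>R\<close> doubles\<close>

definition mixed where "mixed U B Z = {e \<in> E. e \<subseteq> U \<and> \<not> e \<subseteq> B \<and> \<not> e \<subseteq> Z \<and> \<not> e \<subseteq> U - B - Z}"

lemma mixed_subset: "mixed U B Z \<subseteq> E"
  by (auto simp: mixed_def)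

lemma doubling_step_half:
  assumes U: "U \<subseteq> V" "R \<inter> U \<noteq> {}" and m: "2 * m \<le> card U"
  shows "\<exists>B Z. B \<subseteq> U \<and> Z \<subseteq> U \<and> B \<inter> Z = {} \<and> card B \<le> m \<and> m \<le> card B + card Z \<and>
    2 * card (R \<inter> U) * card Z \<le> card U * card (R \<inter> Z) \<and>
    real (card (mixed U B Z)) \<le> real t * real D * (log 2 (real (card U) / real (card (R \<inter> U))) + 4)"
proof -
  have finU: "finite U" using U finV finite_subset by blast
  define n where "n = card U"
  \<comment> \<open>Sorting by \<open>key\<close> gives the cyclic order: block by block, the
    elements of \<open>R\<close> first within each block.\<close>
  define key where "key v = 2 * block v + (if v \<in> R then 0 else 1)" for v
  obtain ys where ys: "set ys = U" "distinct ys" using finite_distinct_list[OF finU] by blast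
  define xs where "xs = sort_key key ys"
  have xs: "set xs = U" "distinct xs" "sorted (map key xs)" using ys by (auto simp: xs_def)
  have len: "length xs = n" using distinct_card[OF xs(2)] xs(1) by (simp add: n_def)
  define el where "el y = xs ! y" for y
  have el_U: "el y \<in> U" if "y < n" for y using that xs len by (auto simp: el_def)
  have inj: "inj_on el {..<n}" using xs(2) len by (auto simp: el_def inj_on_def nth_eq_iff_index_eq)
  have surj: "\<exists>y<n. el y = v" if "v \<in> U" for v
    using that xs(1) len by (auto simp: el_def in_set_conv_nth)
  have key_mono: "key (el y) \<le> key (el z)" if "y \<le> z" "z < n" for y z
    using sorted_nth_mono[OF xs(3), of y z] that len by (simp add: el_def)
  define b where "b y = block (el y)" for y
  define P where "P = {y. y < n \<and> el y \<in> R}"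
  have b_mono: "b y \<le> b z" if "y \<le> z" "z < n" for y z
    using key_mono[OF that] by (auto simp: key_def b_def split: if_splits)
  have conv: "z \<notin> P" if "y \<le> z" "z < n" "b y = b z" "y \<notin> P" for y z
    using key_mono[OF that(1,2)] that by (auto simp: key_def b_def P_def split: if_splits)
  have card_im: "card (el ` A) = card A" if "A \<subseteq> {..<n}" for A
    by (rule card_image[OF inj_on_subset[OF inj that]])
  have Pn: "P \<subseteq> {..<n}" by (auto simp: P_def)
  have elP: "el ` P = R \<inter> U" using surj el_U by (auto simp: P_def image_iff) 
  have cP: "card P = card (R \<inter> U)" using card_im[OF Pn] elP by simp
  have Pne: "P \<noteq> {}" using elP U by auto
  have n0: "0 < n" using Pne Pn by auto
  have finRU: "finite (R \<inter> U)" using finU by simp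
  have r0: "0 < card (R \<inter> U)" using U finRU by (simp add: card_gt_0_iff)
  have rn: "card (R \<inter> U) \<le> n" unfolding n_def using finU by (intro card_mono) auto
  have meets: "e \<in> touch (\<Union>i\<in>I. Y i)"
    if e: "e \<in> E" "e \<subseteq> U" "el y \<in> e" "el z \<in> e"
      and s: "(\<exists>i\<in>I. b y \<le> i \<and> i \<le> b z) \<and> \<not> (y \<notin> P \<and> z \<notin> P \<and> b y = b z)" "y < n" "z < n"
    for e y z I
  proof -
    obtain i where i: "i \<in> I" "b y \<le> i" "i \<le> b z" using s by blast
    have "\<not> (el y \<notin> R \<and> el z \<notin> R \<and> block (el y) = block (el z))" using s by (auto simp: P_def b_def)
    then have "e \<inter> Y i \<noteq> {}"
      using edge_meets_bag[OF e(1) _ e(3,4), of i] e(2) U i by (auto simp: b_def)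
    then show ?thesis using e i by (auto simp: touch_def)
  qed
  have in_im: "el y \<in> el ` A \<longleftrightarrow> y \<in> A" if "A \<subseteq> {..<n}" "y < n" for A y
    using inj_on_image_mem_iff[OF inj] that by auto
  have bN: "b y < N" if "y < n" for y
    using block_less[of "el y"] el_U[OF that] U k by (auto simp: b_def)
  show ?thesis
  proof (cases "\<exists>x\<in>P. (x + m) mod n \<in> P")
    case True
    then obtain x where x: "x \<in> P" "(x + m) mod n \<in> P" by blast
    define z where "z = (x + m) mod n"
    have xn: "x < n" "z < n" "z \<in> P" using x Pn n0 by (auto simp: z_def)
    have mn: "m < n" using m n0 by (simp add: n_def)
    have z: "z = (if x + m < n then x + m else x + m - n)" using xn mn by (simp add: z_def mod_if)
    \<comment> \<open>The cyclic interval of \<open>m\<close> positions from \<open>x\<close>. It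
      begins at an element of \<open>R\<close> and stops just before another, so two bags meet all
      cut edges and \<open>Z\<close> can be empty.\<close>
    define A where "A = (if x + m < n then {x..<z} else {x..<n} \<union> {..<z})"
    have An: "A \<subseteq> {..<n}" using xn by (auto simp: A_def)
    have cA: "card A = m"
    proof (cases "x + m < n")
      case False
      then have "{x..<n} \<inter> {..<z} = {}" using z mn by auto
      then show ?thesis using False z xn by (simp add: A_def card_Un_disjoint)
    qed (simp add: A_def z)
    define I where "I = {b x, b z}"
    have sep: "(\<exists>i\<in>I. b u \<le> i \<and> i \<le> b v) \<and> \<not> (u \<notin> P \<and> v \<notin> P \<and> b u = b v)"
      if uv: "u < v" "v < n" "(u \<in> A) \<noteq> (v \<in> A)" for u v
    proof -
      have "u < x \<and> x \<le> v \<or> u < z \<and> z \<le> v" using uv by (auto simp: A_def split: if_splits)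
      then obtain c where c: "c \<in> {x, z}" "u < c" "c \<le> v" by blast
      then have cP: "c \<in> P" "c < n" "b c \<in> I" using x(1) xn by (auto simp: I_def)
      have bc: "b u \<le> b c" "b c \<le> b v" using b_mono c uv cP by auto
      moreover have False if "u \<notin> P" "b u = b v"
        using conv[of u c] c cP bc that by auto
      ultimately show ?thesis using cP by blast
    qed
    have "mixed U (el ` A) {} \<subseteq> touch (\<Union>i\<in>I. Y i)"
    proof
      fix e assume e: "e \<in> mixed U (el ` A) {}"
      then obtain u v where uv: "u \<in> e" "u \<notin> el ` A" "v \<in> e" "v \<in> el ` A" "e \<subseteq> U" "e \<in> E"
        by (auto simp: mixed_def)
      then obtain y y' where y: "y < n" "el y = u" "y' < n" "el y' = v" using surj by (meson subsetD)
      then have ne: "y \<notin> A" "y' \<in> A" using uv in_im[OF An] by auto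
      then consider "y < y'" | "y' < y" by (metis linorder_neqE_nat)
      then show "e \<in> touch (\<Union>i\<in>I. Y i)"
      proof cases
        case 1
        then show ?thesis using meets[of e y y' I] sep[of y y'] ne y uv by auto
      next
        case 2
        then show ?thesis using meets[of e y' y I] sep[of y' y] ne y uv by auto
      qed
    qed
    then have "card (mixed U (el ` A) {}) \<le> card (touch (\<Union>i\<in>I. Y i))"
      using finE by (intro card_mono) (auto simp: touch_def)
    also have "\<dots> \<le> card I * t * D" using bN xn by (intro card_touch_bags) (auto simp: I_def)
    also have "\<dots> \<le> 4 * (t * D)"
    proof -
      have "card I \<le> 4" by (simp add: I_def card_insert_if)
      then show ?thesis using mult_le_mono1[of "card I" 4 "t * D"] by (simp only: mult.assoc)
    qed
    finally have "real (card (mixed U (el ` A) {})) \<le> real (4 * (t * D))" by (simp only: of_nat_le_iff)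
    also have "\<dots> = real t * real D * (0 + 4)" by simp
    also have "\<dots> \<le> real t * real D * (log 2 (real (card U) / real (card (R \<inter> U))) + 4)"
      using r0 rn by (intro mult_left_mono add_right_mono) (auto simp: n_def)
    finally have cost: "real (card (mixed U (el ` A) {})) \<le> \<dots>" .
    show ?thesis
      using cost cA card_im[OF An] An el_U
      by (intro exI[of _ "el ` A"] exI[of _ "{}"]) auto
  next
    case False
    define S where "S = (\<lambda>w. {y. y < n \<and> y \<notin> P \<and> b y = w})"
    have miss: "\<forall>x\<in>P. (x + m) mod n \<notin> P" using False by blast
    have mono: "\<forall>y z. y \<le> z \<and> z < n \<longrightarrow> b y \<le> b z" using b_mono by blast
    have first: "\<forall>y z. y \<le> z \<and> z < n \<and> b y = b z \<and> y \<notin> P \<longrightarrow> z \<notin> P" using conv by blast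
    have m': "2 * m \<le> n" using m by (simp add: n_def)
    from circle_separation[OF Pn Pne m' mono first miss]
    obtain w A C I where A: "A \<subseteq> {..<n} - S w" and C: "C \<subseteq> {..<n} - S w" and AC: "A \<inter> C = {}" "A \<noteq> {}"
      and size: "card C \<le> m" "m \<le> card C + card A + card (S w)"
      and dense: "2 * card P * card A \<le> n * card (P \<inter> A)"
      and I: "finite I" "I \<subseteq> b ` {..<n}" "card I \<le> 4" "2 ^ card I * (card P * card (S w)) \<le> 8 * (n * card A)"
      and sep: "\<forall>u v. u < v \<and> v < n \<and> ((u \<in> A) \<noteq> (v \<in> A) \<or> (u \<in> C) \<noteq> (v \<in> C) \<or> (u \<in> S w) \<noteq> (v \<in> S w)) \<longrightarrow>
        (\<exists>i\<in>I. b u \<le> i \<and> i \<le> b v) \<and> \<not> (u \<notin> P \<and> v \<notin> P \<and> b u = b v)"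
      unfolding S_def by (elim exE conjE)
    have An: "A \<subseteq> {..<n}" and Cn: "C \<subseteq> {..<n}" and Sn: "S w \<subseteq> {..<n}" using A C by (auto simp: S_def)
    define Z where "Z = el ` A"
    define B0 where "B0 = el ` C"
    define T where "T = el ` S w"
    have sub: "Z \<subseteq> U" "B0 \<subseteq> U" "T \<subseteq> U" using An Cn Sn el_U by (auto simp: Z_def B0_def T_def)
    have disj: "Z \<inter> B0 = {}" "Z \<inter> T = {}" "B0 \<inter> T = {}"
      using inj_on_image_Int[OF inj An Cn] inj_on_image_Int[OF inj An Sn] inj_on_image_Int[OF inj Cn Sn] A C AC
      by (auto simp: Z_def B0_def T_def)
    have cards: "card Z = card A" "card B0 = card C" "card T = card (S w)"
      using card_im An Cn Sn by (auto simp: Z_def B0_def T_def)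
    have finZ: "finite Z" using sub finU finite_subset by blast
    have finB0: "finite B0" using sub finU finite_subset by blast
    have finT: "finite T" using sub finU finite_subset by blast
    have zpos: "0 < card Z" using finZ AC by (simp add: card_gt_0_iff Z_def)
    \<comment> \<open>\<open>K\<close> halvings bring the error inside \<open>T\<close> down to at
      most \<open>card Z\<close>, and together with the bags in \<open>I\<close> they stay within
      the allowed number of bags.\<close>
    obtain K where K: "card T \<le> 2 ^ K * card Z"
      "real (card I + K) \<le> log 2 (real n / real (card (R \<inter> U))) + 4"
      using halving_exponent[OF r0 rn zpos I(3), of "card T"] I(4) by (auto simp: cP cards)
    obtain T' where T': "T' \<subseteq> T" "card T' \<le> m - card B0" "m \<le> card B0 + card T' + card Z"
      "card (cross T T') \<le> K * t * D"
    proof (cases "m - card B0 \<le> card T")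
      case True
      have "T \<subseteq> V" using sub U by blast
      then obtain T' where T': "T' \<subseteq> T" "card T' \<le> m - card B0" "(m - card B0 - card T') * 2 ^ K \<le> card T"
        "card (cross T T') \<le> K * t * D"
        using approximate_cut[OF _ True, of K] by blast
      have "(m - card B0 - card T') * 2 ^ K \<le> card Z * 2 ^ K" by (rule order_trans[OF T'(3)]) (use K(1) in \<open>simp only: mult.commute\<close>)
      then have "m - card B0 - card T' \<le> card Z" by simp
      then show thesis using that[of T'] T' by linarith
    next
      case False
      \<comment> \<open>\<open>T\<close> is smaller than the demand and is taken whole at no cost;
        by \<open>size\<close> the remainder fits into \<open>Z\<close>.\<close>
      have "cross T T = {}" by (auto simp: cross_def)
      then show thesis using that[of T] False size cards by simp
    qed
    define B where "B = B0 \<union> T'"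
    have finT': "finite T'" using T'(1) finT finite_subset by blast
    have cB: "card B = card B0 + card T'"
      unfolding B_def using disj T'(1) finB0 finT' by (intro card_Un_disjoint) auto
    have "mixed U B Z \<subseteq> touch (\<Union>i\<in>I. Y i) \<union> cross T T'"
    proof
      fix e assume e: "e \<in> mixed U B Z"
      have eE: "e \<in> E" "e \<subseteq> U" using e by (auto simp: mixed_def)
      show "e \<in> touch (\<Union>i\<in>I. Y i) \<union> cross T T'"
      proof (cases "e \<subseteq> T")
        case True
        have "e \<inter> Z = {}" "e \<inter> B0 = {}" using True disj by auto
        then have "e \<inter> T' \<noteq> {}" "\<not> e \<subseteq> T'" using e by (auto simp: mixed_def B_def)
        then show ?thesis using eE True by (auto simp: cross_def)
      next
        case False
        have "\<exists>u\<in>e. \<exists>v\<in>e. (u \<in> Z) \<noteq> (v \<in> Z) \<or> (u \<in> B0) \<noteq> (v \<in> B0) \<or> (u \<in> T) \<noteq> (v \<in> T)"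
        proof (rule ccontr)
          assume "\<not> ?thesis"
          then have same: "(u \<in> Z) = (v \<in> Z)" "(u \<in> B0) = (v \<in> B0)" "(u \<in> T) = (v \<in> T)"
            if "u \<in> e" "v \<in> e" for u v using that by blast+
          obtain v where v: "v \<in> e" "v \<notin> T" using False by auto
          have "e \<inter> T = {}" using same(3)[OF v(1)] v by blast
          moreover have "e \<subseteq> Z \<or> e \<inter> Z = {}" using same(1)[OF v(1)] by blast
          moreover have "e \<subseteq> B0 \<or> e \<inter> B0 = {}" using same(2)[OF v(1)] by blast
          ultimately show False using e T'(1) by (auto simp: mixed_def B_def)
        qed
        then obtain u v where uv: "u \<in> e" "v \<in> e"
          "(u \<in> Z) \<noteq> (v \<in> Z) \<or> (u \<in> B0) \<noteq> (v \<in> B0) \<or> (u \<in> T) \<noteq> (v \<in> T)" by blast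
        obtain y z where y: "y < n" "el y = u" "z < n" "el z = v" using surj uv eE by (meson subsetD)
        have ne: "(y \<in> A) \<noteq> (z \<in> A) \<or> (y \<in> C) \<noteq> (z \<in> C) \<or> (y \<in> S w) \<noteq> (z \<in> S w)"
          using uv(3) in_im[OF An] in_im[OF Cn] in_im[OF Sn] y unfolding Z_def B0_def T_def by blast
        then consider "y < z" | "z < y" by (metis linorder_neqE_nat)
        then have "e \<in> touch (\<Union>i\<in>I. Y i)"
        proof cases
          case 1
          then show ?thesis using meets[of e y z I] sep[rule_format, of y z] ne y uv eE by blast
        next
          case 2
          then show ?thesis using meets[of e z y I] sep[rule_format, of z y] ne y uv eE by blast
        qed
        then show ?thesis by blast
      qed
    qed
    then have "card (mixed U B Z) \<le> card (touch (\<Union>i\<in>I. Y i) \<union> cross T T')"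
      using finE by (intro card_mono) (auto simp: touch_def cross_def)
    also have "\<dots> \<le> card (touch (\<Union>i\<in>I. Y i)) + card (cross T T')" by (rule card_Un_le)
    also have "\<dots> \<le> card I * t * D + K * t * D"
      using card_touch_bags[OF I(1)] I(2) bN T'(4) by (intro add_mono) auto
    finally have "real (card (mixed U B Z)) \<le> real (card I * t * D + K * t * D)" by (simp only: of_nat_le_iff)
    also have "\<dots> = real t * real D * real (card I + K)" by (simp add: algebra_simps)
    also have "\<dots> \<le> real t * real D * (log 2 (real (card U) / real (card (R \<inter> U))) + 4)"
      using K(2) by (intro mult_left_mono) (auto simp: n_def)
    finally have cost: "real (card (mixed U B Z)) \<le> \<dots>" .
    have "el ` (P \<inter> A) = R \<inter> Z" using An by (auto simp: P_def Z_def)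
    moreover have "card (el ` (P \<inter> A)) = card (P \<inter> A)" using An by (intro card_im) auto
    ultimately have "2 * card (R \<inter> U) * card Z \<le> card U * card (R \<inter> Z)"
      using dense by (simp add: cP cards n_def)
    moreover have "B \<subseteq> U" "B \<inter> Z = {}" using sub T'(1) disj by (auto simp: B_def)
    moreover have "card B \<le> m" "m \<le> card B + card Z" using cB T'(2,3) size(1) cards by auto
    ultimately show ?thesis using cost sub(1) by blast
  qed
qed

text \<open>For \<open>m\<close> above half, the complementary size is split off and
  \<open>B\<close> is exchanged with the third part; \<open>mixed\<close> is symmetric in these
  two.\<close>

lemma doubling_step:
  assumes U: "U \<subseteq> V" "R \<inter> U \<noteq> {}" and m: "m \<le> card U"
  shows "\<exists>B Z. B \<subseteq> U \<and> Z \<subseteq> U \<and> B \<inter> Z = {} \<and> card B \<le> m \<and> m \<le> card B + card Z \<and>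
    2 * card (R \<inter> U) * card Z \<le> card U * card (R \<inter> Z) \<and>
    real (card (mixed U B Z)) \<le> real t * real D * (log 2 (real (card U) / real (card (R \<inter> U))) + 4)"
proof (cases "2 * m \<le> card U")
  case True
  then show ?thesis using doubling_step_half U by blast
next
  case False
  then have "2 * (card U - m) \<le> card U" by simp
  from doubling_step_half[OF U this]
  obtain B Z where BZ: "B \<subseteq> U" "Z \<subseteq> U" "B \<inter> Z = {}" "card B \<le> card U - m" "card U - m \<le> card B + card Z"
    "2 * card (R \<inter> U) * card Z \<le> card U * card (R \<inter> Z)"
    "real (card (mixed U B Z)) \<le> real t * real D * (log 2 (real (card U) / real (card (R \<inter> U))) + 4)"
    by (elim exE conjE)
  have finU: "finite U" using U finV finite_subset by blast
  have fin: "finite B" "finite Z" using BZ finU finite_subset by blast+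
  have "card (U - B - Z) = card U - (card B + card Z)"
  proof -
    have "U - B - Z = U - (B \<union> Z)" by blast
    moreover have "card (U - (B \<union> Z)) = card U - card (B \<union> Z)" using BZ fin by (intro card_Diff_subset) auto
    ultimately show ?thesis using BZ(3) fin by (simp add: card_Un_disjoint)
  qed
  moreover have "card B + card Z \<le> card U"
    using card_mono[OF finU, of "B \<union> Z"] BZ fin by (simp add: card_Un_disjoint)
  moreover have "mixed U (U - B - Z) Z = mixed U B Z"
  proof -
    have "U - (U - B - Z) - Z = B" using BZ by blast
    then show ?thesis by (auto simp: mixed_def)
  qed
  ultimately show ?thesis using BZ m
    by - (rule exI[of _ "U - B - Z"], rule exI[of _ Z], auto)
qed

section \<open>Iteration to an exact partition\<close>

definition cost where "cost L = (L\<^sup>2 + 9 * L + 8) / 2" for L :: real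

text \<open>Induction on the size of \<open>U\<close>: the density of \<open>R\<close> cannot double
  on \<open>U\<close> itself, so \<open>Z\<close> is smaller, and doubling lowers the logarithm by
  at least \<open>1\<close>. When \<open>Z\<close> is empty, \<open>B\<close> already has size
  \<open>m\<close>.\<close>

lemma exact_cut:
  assumes "U \<subseteq> V" "R \<inter> U \<noteq> {}" "m \<le> card U"
  shows "\<exists>B\<subseteq>U. card B = m \<and>
    real (card (cross U B)) \<le> real t * real D * cost (log 2 (real (card U) / real (card (R \<inter> U))))"
  using assms
proof (induction "card U" arbitrary: U m rule: less_induct)
  case less
  define L where "L = log 2 (real (card U) / real (card (R \<inter> U)))"
  have finU: "finite U" using less.prems finV finite_subset by blast
  have r0: "0 < card (R \<inter> U)" using less.prems finU by (simp add: card_gt_0_iff)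
  have rn: "card (R \<inter> U) \<le> card U" using finU by (intro card_mono) auto
  have L0: "0 \<le> L" using r0 rn by (simp add: L_def)
  obtain B Z where BZ: "B \<subseteq> U" "Z \<subseteq> U" "B \<inter> Z = {}" "card B \<le> m" "m \<le> card B + card Z"
    "2 * card (R \<inter> U) * card Z \<le> card U * card (R \<inter> Z)"
    "real (card (mixed U B Z)) \<le> real t * real D * (L + 4)"
    using doubling_step[OF less.prems] unfolding L_def by (elim exE conjE)
  have fin: "finite B" "finite Z" using BZ finU finite_subset by blast+
  show ?case
  proof (cases "Z = {}")
    case True
    have "cross U B \<subseteq> mixed U B Z" using True by (auto simp: cross_def mixed_def)
    then have "card (cross U B) \<le> card (mixed U B Z)"
      using finite_subset[OF mixed_subset finE] by (intro card_mono)
    then have "real (card (cross U B)) \<le> real t * real D * (L + 4)" using BZ(7) by linarith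
    also have "\<dots> \<le> real t * real D * cost L"
      using L0 by (intro mult_left_mono) (auto simp: cost_def)
    finally show ?thesis using BZ True unfolding L_def by (intro exI[of _ B]) auto
  next
    case False
    have z0: "0 < card Z" using False fin by (simp add: card_gt_0_iff)
    have RZ: "0 < card (R \<inter> Z)"
    proof (rule ccontr)
      assume "\<not> 0 < card (R \<inter> Z)"
      then show False using BZ(6) r0 z0 by simp
    qed
    have "Z \<noteq> U"
    proof
      assume "Z = U"
      then show False using BZ(6) r0 z0 by simp
    qed
    then have zU: "card Z < card U" using BZ(2) finU by (intro psubset_card_mono) auto
    define L' where "L' = log 2 (real (card Z) / real (card (R \<inter> Z)))"
    have rz: "card (R \<inter> Z) \<le> card Z" using fin by (intro card_mono) auto
    have L'0: "0 \<le> L'" using RZ rz by (simp add: L'_def)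
    have "real (2 * card (R \<inter> U) * card Z) \<le> real (card U * card (R \<inter> Z))" using BZ(6) by (simp only: of_nat_le_iff)
    then have "2 * (real (card Z) / real (card (R \<inter> Z))) \<le> real (card U) / real (card (R \<inter> U))"
      using RZ r0 by (simp add: field_simps)
    then have "log 2 (2 * (real (card Z) / real (card (R \<inter> Z)))) \<le> L"
      unfolding L_def using z0 RZ r0 zU by (subst log_le_cancel_iff) auto
    moreover have "log 2 (2 * (real (card Z) / real (card (R \<inter> Z)))) = log 2 2 + L'"
      unfolding L'_def using z0 RZ by (intro log_mult_pos) auto
    ultimately have LL: "L' + 1 \<le> L" by simp
    have "R \<inter> Z \<noteq> {}" using RZ by auto
    moreover have "Z \<subseteq> V" using BZ(2) less.prems(1) by blast
    moreover have "m - card B \<le> card Z" using BZ(5) by simp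
    ultimately obtain A where A: "A \<subseteq> Z" "card A = m - card B"
      "real (card (cross Z A)) \<le> real t * real D * cost L'"
      using less.hyps[OF zU, of "m - card B"] unfolding L'_def by blast
    have finA: "finite A" using A fin finite_subset by blast
    have "card (B \<union> A) = card B + card A" using BZ A fin finA by (intro card_Un_disjoint) auto
    then have cBA: "card (B \<union> A) = m" using A(2) BZ(4) by simp
    have "cross U (B \<union> A) \<subseteq> mixed U B Z \<union> cross Z A"
      using BZ A by (auto simp: cross_def mixed_def)
    then have "card (cross U (B \<union> A)) \<le> card (mixed U B Z \<union> cross Z A)"
      using finE by (intro card_mono) (auto simp: mixed_def cross_def)
    also have "\<dots> \<le> card (mixed U B Z) + card (cross Z A)" by (rule card_Un_le)
    finally have "real (card (cross U (B \<union> A))) \<le> real t * real D * (L + 4) + real t * real D * cost L'"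
      using BZ(7) A(3) by linarith
    \<comment> \<open>\<open>cost\<close> increases on nonnegative arguments, so a drop by exactly
      \<open>1\<close> is the worst case.\<close>
    also have "\<dots> \<le> real t * real D * (L + 4) + real t * real D * cost (L - 1)"
    proof -
      have "L'\<^sup>2 \<le> (L - 1)\<^sup>2" using LL L'0 by (intro power_mono) auto
      then have "cost L' \<le> cost (L - 1)" using LL by (simp add: cost_def)
      then show ?thesis by (intro add_left_mono mult_left_mono) auto
    qed
    also have "\<dots> = real t * real D * cost L"
      by (simp add: cost_def power2_eq_square algebra_simps)
    finally show ?thesis using cBA BZ A unfolding L_def by (intro exI[of _ "B \<union> A"]) auto
  qed
qed

end

section \<open>Enumerating the nodes of a tree\<close>

lemma rtrancl_exit:
  assumes "(a, b) \<in> r\<^sup>*" "a \<in> A" "b \<notin> A"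
  shows "\<exists>x y. (x, y) \<in> r \<and> x \<in> A \<and> y \<notin> A"
  using assms by (induction rule: rtrancl_induct) blast+

lemma vwalk_arcs_nth:
  "Suc i < length p \<Longrightarrow> (p ! i, p ! Suc i) \<in> set (vwalk_arcs p)"
proof (induction p arbitrary: i rule: vwalk_arcs.induct)
  case (3 x y xs)
  then show ?case by (cases i) auto
qed auto

lemma list_exit:
  assumes "xs \<noteq> []" "P (hd xs)" "\<not> P (last xs)"
  shows "\<exists>i. Suc i < length xs \<and> P (xs ! i) \<and> \<not> P (xs ! Suc i)"
  using assms
proof (induction xs)
  case (Cons x xs)
  show ?case
  proof (cases "xs \<noteq> [] \<and> P (hd xs)")
    case True
    then obtain i where "Suc i < length xs" "P (xs ! i)" "\<not> P (xs ! Suc i)" using Cons by auto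
    then show ?thesis by (intro exI[of _ "Suc i"]) auto
  next
    case False
    then have "xs \<noteq> []" "\<not> P (hd xs)" using Cons.prems by (auto split: if_splits)
    then show ?thesis using Cons.prems by (intro exI[of _ 0]) (auto simp: hd_conv_nth)
  qed
qed simp

lemma pawalk_verts_vwalk_arcs: "xs \<noteq> [] \<Longrightarrow> pawalk_verts (hd xs) (vwalk_arcs xs) = xs"
  by (induction xs rule: vwalk_arcs.induct) auto

lemma pcas_vwalk_arcs: "xs \<noteq> [] \<Longrightarrow> pcas (hd xs) (vwalk_arcs xs) (last xs)"
  by (induction xs rule: vwalk_arcs.induct) auto

lemma vpath_closed_is_cycle:
  fixes T :: "'b pair_pre_digraph"
  assumes T: "pair_graph T" and xs: "vpath xs T" and h: "h \<notin> set xs"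
    and arcs: "(h, hd xs) \<in> parcs T" "(last xs, h) \<in> parcs T"
  shows "pre_digraph.cycle T (vwalk_arcs (h # xs @ [h]))"
proof -
  interpret pair_graph T by (rule T)
  have ne: "xs \<noteq> []" "distinct xs" and walk: "set (vwalk_arcs xs) \<subseteq> parcs T"
    using xs by (auto simp: vpath_def vwalk_def)
  have eq: "vwalk_arcs (h # xs @ [h]) = (h, hd xs) # vwalk_arcs xs @ [(last xs, h)]"
    using ne by (simp add: vwalk_arcs_append)
  have "pcas h (vwalk_arcs (h # xs @ [h])) h"
    using pcas_vwalk_arcs[of "h # xs @ [h]"] by simp
  moreover have "pawalk_verts h (vwalk_arcs (h # xs @ [h])) = h # xs @ [h]"
    using pawalk_verts_vwalk_arcs[of "h # xs @ [h]"] by simp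
  moreover have "h \<in> pverts T" using arcs in_arcsD1 by blast
  ultimately show ?thesis
    unfolding cycle_def awalk_def using eq walk arcs ne h by (intro exI[of _ h]) auto
qed

text \<open>The unique earlier neighbour serves as parent once the tree is rooted at the first node.
  The list may stop short of all nodes, so that it can be grown node by node.\<close>

definition tree_enumeration :: "'b pair_pre_digraph \<Rightarrow> 'b list \<Rightarrow> bool" where
  "tree_enumeration T hs \<longleftrightarrow> hs \<noteq> [] \<and> distinct hs \<and> set hs \<subseteq> pverts T \<and>
     (\<forall>j. 0 < j \<and> j < length hs \<longrightarrow> (\<exists>!i. i < j \<and> (hs ! i, hs ! j) \<in> parcs T))"

text \<open>Both nodes are joined to the first one through earlier neighbours. Staying inside the
  list keeps the path away from any node still to be appended.\<close>

lemma tree_enumeration_vpath: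
  fixes T :: "'b pair_pre_digraph"
  assumes T: "pair_graph T" and hs: "tree_enumeration T hs" and ab: "a \<in> set hs" "b \<in> set hs"
  shows "\<exists>p. vpath p T \<and> hd p = a \<and> last p = b \<and> set p \<subseteq> set hs"
proof -
  interpret pair_graph T by (rule T)
  define r where "r = parcs T \<inter> set hs \<times> set hs"
  have "sym (parcs T)" using sym_arcs by (simp add: symmetric_def)
  then have "sym r" by (auto simp: r_def sym_def)
  have root: "(hs ! 0, hs ! j) \<in> r\<^sup>*" if "j < length hs" for j
    using that
  proof (induction j rule: less_induct)
    case (less j)
    show ?case
    proof (cases "j = 0")
      case False
      then obtain i where i: "i < j" "(hs ! i, hs ! j) \<in> parcs T"
        using hs less.prems by (auto simp: tree_enumeration_def)
      then have "(hs ! i, hs ! j) \<in> r" using less.prems by (auto simp: r_def)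
      moreover have "(hs ! 0, hs ! i) \<in> r\<^sup>*" using less i by auto
      ultimately show ?thesis by (rule rtrancl_into_rtrancl[rotated])
    qed simp
  qed
  have "(hs ! 0, a) \<in> r\<^sup>*" "(hs ! 0, b) \<in> r\<^sup>*" using ab root by (auto simp: in_set_conv_nth)
  then have "(a, b) \<in> r\<^sup>*" using \<open>sym r\<close> by (meson rtrancl_trans sym_rtrancl symD)
  then have "\<exists>p. vwalk p T \<and> hd p = a \<and> last p = b \<and> set p \<subseteq> set hs"
  proof (induction rule: rtrancl_induct)
    case base
    then show ?case using ab hs by (intro exI[of _ "[a]"]) (auto simp: vwalk_def tree_enumeration_def)
  next
    case (step y z)
    then obtain p where p: "vwalk p T" "hd p = a" "last p = y" "set p \<subseteq> set hs" by blast
    have "z \<in> set hs" "z \<in> pverts T" "(y, z) \<in> parcs T" using step(2) hs by (auto simp: r_def tree_enumeration_def)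
    then show ?case using p
      by (intro exI[of _ "p @ [z]"]) (auto simp: vwalk_def set_vwalk_arcs_snoc)
  qed
  then obtain p where p: "vwalk p T" "hd p = a" "last p = b" "set p \<subseteq> set hs" by blast
  have "set (vwalk_to_vpath p) \<subseteq> set hs" using p(4) vwalk_to_vpath_subset by fast
  then show ?thesis
    using p vwalk_to_vpath_vpath[OF p(1)] vwalk_to_vpath_hd[of p] vwalk_to_vpath_last[of p]
    by (intro exI[of _ "vwalk_to_vpath p"]) auto
qed

text \<open>A second neighbour of \<open>h\<close> in the list, together with a path inside the list
  between the two, would close a cycle of length at least \<open>3\<close>.\<close>

lemma tree_enumeration_snoc:
  fixes T :: "'b pair_pre_digraph"
  assumes T: "undirected_tree T" and hs: "tree_enumeration T hs"
    and h: "h \<notin> set hs" "a \<in> set hs" "(a, h) \<in> parcs T"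
  shows "tree_enumeration T (hs @ [h])"
proof -
  have pg: "pair_graph T" using T by (simp add: undirected_tree_def)
  interpret pair_graph T by (rule pg)
  have symT: "(v, u) \<in> parcs T" if "(u, v) \<in> parcs T" for u v
    using that sym_arcs by (auto simp: symmetric_def sym_def)
  have unique: "x = y" if xy: "x \<in> set hs" "y \<in> set hs" "(x, h) \<in> parcs T" "(y, h) \<in> parcs T" for x y
  proof (rule ccontr)
    assume "x \<noteq> y"
    obtain p where p: "vpath p T" "hd p = x" "last p = y" "set p \<subseteq> set hs"
      using tree_enumeration_vpath[OF pg hs xy(1,2)] by blast
    have "pre_digraph.cycle T (vwalk_arcs (h # p @ [h]))"
      using p xy symT h by (intro vpath_closed_is_cycle[OF pg]) auto
    moreover have "2 \<le> length p" using p \<open>x \<noteq> y\<close>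
      by (cases p; cases "tl p") (auto simp: vpath_def vwalk_def)
    then have "3 \<le> length (vwalk_arcs (h # p @ [h]))"
      using vwalk_length_simp[of "h # p @ [h]"] by (simp only: vwalk_length_def) simp
    ultimately show False using T by (auto simp: undirected_tree_def)
  qed
  have "\<exists>!i. i < j \<and> ((hs @ [h]) ! i, (hs @ [h]) ! j) \<in> parcs T" if j: "0 < j" "j < length (hs @ [h])" for j
  proof (cases "j < length hs")
    case True
    then have "\<exists>!i. i < j \<and> (hs ! i, hs ! j) \<in> parcs T" using hs j by (auto simp: tree_enumeration_def)
    moreover have "i < j \<and> ((hs @ [h]) ! i, (hs @ [h]) ! j) \<in> parcs T \<longleftrightarrow> i < j \<and> (hs ! i, hs ! j) \<in> parcs T" for i
      using True by (auto simp: nth_append)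
    ultimately show ?thesis by simp
  next
    case False
    then have jl: "j = length hs" using j by simp
    obtain l where l: "l < length hs" "hs ! l = a" using h by (auto simp: in_set_conv_nth)
    show ?thesis
    proof (rule ex1I[of _ l])
      show "l < j \<and> ((hs @ [h]) ! l, (hs @ [h]) ! j) \<in> parcs T" using l h jl by (simp add: nth_append)
      fix i assume i: "i < j \<and> ((hs @ [h]) ! i, (hs @ [h]) ! j) \<in> parcs T"
      then have "hs ! i = hs ! l" using unique[of "hs ! i" a] l h jl by (auto simp: nth_append)
      then show "i = l" using hs i l jl by (auto simp: tree_enumeration_def nth_eq_iff_index_eq)
    qed
  qed
  then show ?thesis using hs h in_arcsD2 by (auto simp: tree_enumeration_def)
qed

text \<open>Lets the heaviest path open the enumeration, so that its nodes receive the numbers below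
  \<open>k\<close>.\<close>

lemma tree_enumeration_path:
  fixes T :: "'b pair_pre_digraph"
  assumes T: "undirected_tree T" and "vpath p T"
  shows "tree_enumeration T p"
  using assms(2)
proof (induction p rule: rev_induct)
  case Nil
  then show ?case by (simp add: vpath_def vwalk_def)
next
  case (snoc x p)
  show ?case
  proof (cases "p = []")
    case True
    then show ?thesis using snoc.prems by (simp add: tree_enumeration_def vpath_def vwalk_def)
  next
    case False
    have "vpath p T" using snoc.prems False vwalkI_append_l[OF False, of "[x]"] by (auto simp: vpath_def)
    then show ?thesis
      using snoc False set_vwalk_arcs_snoc[OF False, of x]
      by (intro tree_enumeration_snoc[OF T _ _ last_in_set[OF False]]) (auto simp: vpath_def vwalk_def)
  qed
qed

lemma undirected_tree_reachable:
  fixes T :: "'b pair_pre_digraph"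
  assumes T: "undirected_tree T" and uv: "u \<in> pverts T" "v \<in> pverts T"
  shows "u \<rightarrow>\<^sup>*\<^bsub>with_proj T\<^esub> v"
proof -
  interpret pair_graph T using T by (simp add: undirected_tree_def)
  have "strongly_connected (mk_symmetric T)" using T by (simp add: undirected_tree_def connected_def)
  then have "u \<rightarrow>\<^sup>*\<^bsub>mk_symmetric T\<^esub> v" using uv by (auto simp: strongly_connected_def mk_symmetric_def)
  then show ?thesis using reachable_mk_symmetric_eq[OF sym_arcs] by blast
qed

text \<open>While nodes are missing, connectivity gives an arc leaving the list, whose head is
  appended.\<close>

lemma tree_enumeration_extend:
  fixes T :: "'b pair_pre_digraph"
  assumes T: "undirected_tree T" and "tree_enumeration T hs"
  shows "\<exists>rest. tree_enumeration T (hs @ rest) \<and> set (hs @ rest) = pverts T"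
  using assms(2)
proof (induction "card (pverts T - set hs)" arbitrary: hs rule: less_induct)
  case less
  interpret pair_graph T using T by (simp add: undirected_tree_def)
  have sub: "hs \<noteq> []" "set hs \<subseteq> pverts T" using less.prems by (auto simp: tree_enumeration_def)
  show ?case
  proof (cases "set hs = pverts T")
    case True
    then show ?thesis using less.prems by (intro exI[of _ "[]"]) simp
  next
    case False
    then obtain y where y: "y \<in> pverts T" "y \<notin> set hs" using sub by blast
    have "(hd hs, y) \<in> (parcs T)\<^sup>*"
    proof -
      have "hd hs \<in> pverts T" using sub hd_in_set[OF sub(1)] by blast
      then show ?thesis
        using reachable_rtranclI[OF undirected_tree_reachable[OF T _ y(1)]] by simp
    qed
    then obtain a h where ah: "(a, h) \<in> parcs T" "a \<in> set hs" "h \<notin> set hs"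
      using rtrancl_exit[of "hd hs" y "parcs T" "set hs"] sub y by auto
    have "card (pverts T - set (hs @ [h])) < card (pverts T - set hs)"
      using ah in_arcsD2 by (intro psubset_card_mono) auto
    then obtain rest where "tree_enumeration T ((hs @ [h]) @ rest)" "set ((hs @ [h]) @ rest) = pverts T"
      using less.hyps tree_enumeration_snoc[OF T less.prems ah(3,2,1)] by blast
    then show ?thesis by (intro exI[of _ "h # rest"]) simp
  qed
qed

section \<open>The main result\<close>

lemma tree_decomposition_rooted:
  fixes G :: "'a pair_pre_digraph" and T :: "'b pair_pre_digraph" and X :: "'b \<Rightarrow> 'a set"
  assumes G: "pair_graph G" and td: "tree_decomposition G T X"
    and width: "td_width T X = int t - 1" and p: "vpath p T"
  shows "\<exists>N par Y. rooted_decomposition N (length p) par Y (pverts G) {{u, v} | u v. (u, v) \<in> parcs G} t (max_degree G) \<and>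
    (\<Union>i<length p. Y i) = (\<Union>x\<in>set p. X x)"
proof -
  interpret G: pair_graph G by (rule G)
  have T: "undirected_tree T" using td by (simp add: tree_decomposition_def)
  interpret T: pair_graph T using T by (simp add: undirected_tree_def)
  have symT: "(v, u) \<in> parcs T" if "(u, v) \<in> parcs T" for u v
    using that T.sym_arcs by (auto simp: symmetric_def sym_def)
  obtain rest where en: "tree_enumeration T (p @ rest)" "set (p @ rest) = pverts T"
    using tree_enumeration_extend[OF T tree_enumeration_path[OF T p]] by blast
  define hs where "hs = p @ rest"
  define N where "N = length hs"
  \<comment> \<open>The default \<open>0\<close> beyond the enumeration keeps
    \<open>par j < j\<close> true for every positive \<open>j\<close>.\<close>
  define par where "par j = (if 0 < j \<and> j < N then THE i. i < j \<and> (hs ! i, hs ! j) \<in> parcs T else 0)" for j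
  define Y where "Y j = X (hs ! j)" for j
  have hs: "distinct hs" "set hs = pverts T"
    and uniq: "\<And>j. 0 < j \<Longrightarrow> j < N \<Longrightarrow> \<exists>!i. i < j \<and> (hs ! i, hs ! j) \<in> parcs T"
    using en by (auto simp: hs_def N_def tree_enumeration_def)
  have par: "par j < j \<and> (hs ! par j, hs ! j) \<in> parcs T" if "0 < j" "j < N" for j
    using theI'[OF uniq[OF that]] that by (simp add: par_def)
  have par_eq: "par j = i" if "i < j" "j < N" "(hs ! i, hs ! j) \<in> parcs T" for i j
    using uniq[of j] par[of j] that by auto
  have node: "hs ! j \<in> pverts T" if "j < N" for j
    using nth_mem[of j hs] that hs(2) by (simp add: N_def)
  have index: "\<exists>j<N. hs ! j = x" if "x \<in> pverts T" for x
    using that unfolding hs(2)[symmetric] in_set_conv_nth N_def by blast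
  have XG: "X x \<subseteq> pverts G" if "x \<in> pverts T" for x
    using td that by (simp add: tree_decomposition_def)
  have "rooted_decomposition N (length p) par Y (pverts G) {{u, v} | u v. (u, v) \<in> parcs G} t (max_degree G)"
  proof
    show "finite (pverts G)" by simp
    have "{{u, v} | u v. (u, v) \<in> parcs G} = (\<lambda>(u, v). {u, v}) ` parcs G" by auto
    then show "finite {{u, v} | u v. (u, v) \<in> parcs G}" using G.finite_arcs by simp
    show "par j < j" if "0 < j" for j
      using that par[of j] by (cases "j < N") (auto simp: par_def)
    show "\<exists>j<N. v \<in> Y j" if v: "v \<in> pverts G" for v
    proof -
      obtain x where "x \<in> pverts T" "v \<in> X x" using td v by (auto simp: tree_decomposition_def)
      then show ?thesis using index[of x] by (auto simp: Y_def)
    qed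
    show "\<exists>j<N. e \<subseteq> Y j" if e: "e \<in> {{u, v} | u v. (u, v) \<in> parcs G}" for e
    proof -
      obtain u v where uv: "e = {u, v}" "(u, v) \<in> parcs G" using e by blast
      then obtain x where "x \<in> pverts T" "{u, v} \<subseteq> X x" using td by (fastforce simp: tree_decomposition_def)
      then show ?thesis using index[of x] uv by (auto simp: Y_def)
    qed
    have connT: "\<forall>i \<in> pverts T. \<forall>j \<in> pverts T. \<forall>p. vpath p T \<and> hd p = i \<and> last p = j \<longrightarrow>
        (\<forall>h \<in> set p. X i \<inter> X j \<subseteq> X h)"
      using td unfolding tree_decomposition_def by (elim conjE)
    show "\<exists>h. 0 < h \<and> h < N \<and> v \<in> Y h \<and> v \<in> Y (par h) \<and> P h \<noteq> P (par h)"
      if ij: "i < N" "j < N" "v \<in> Y i" "v \<in> Y j" "P i" "\<not> P j" for v P i j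
    proof -
      \<comment> \<open>All bags on the tree path \<open>q\<close> contain \<open>v\<close>.
        \<open>P\<close> changes along some arc of \<open>q\<close>, and the larger-numbered end of
        that arc is the required \<open>h\<close>.\<close>
      obtain q where q: "vpath q T" "hd q = hs ! i" "last q = hs ! j"
        using undirected_tree_reachable[OF T node[OF ij(1)] node[OF ij(2)]] T.reachable_vpath_conv by auto
      have vq: "v \<in> X x" if "x \<in> set q" for x
      proof -
        have "X (hs ! i) \<inter> X (hs ! j) \<subseteq> X x"
          using connT[rule_format, of "hs ! i" "hs ! j" q x] q that node[OF ij(1)] node[OF ij(2)] by blast
        then show ?thesis using \<open>v \<in> Y i\<close> \<open>v \<in> Y j\<close> by (auto simp: Y_def)
      qed
      have qT: "q \<noteq> []" "set q \<subseteq> pverts T" "set (vwalk_arcs q) \<subseteq> parcs T"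
        using q(1) by (auto simp: vpath_def vwalk_def)
      define Q where "Q x \<longleftrightarrow> (\<exists>l<N. hs ! l = x \<and> P l)" for x
      have Q: "Q (hs ! l) \<longleftrightarrow> P l" if "l < N" for l
        using that hs(1) by (auto simp: Q_def N_def nth_eq_iff_index_eq)
      obtain l where l: "Suc l < length q" "Q (q ! l)" "\<not> Q (q ! Suc l)"
        using list_exit[OF qT(1), of Q] q Q ij by auto
      have mem: "q ! l \<in> set q" "q ! Suc l \<in> set q" using l(1) by auto
      then obtain a b where ab: "a < N" "hs ! a = q ! l" "b < N" "hs ! b = q ! Suc l"
        using index qT(2) by (meson subsetD)
      have arc: "(hs ! a, hs ! b) \<in> parcs T" using vwalk_arcs_nth[OF l(1)] qT(3) ab by auto
      have vab: "v \<in> Y a" "v \<in> Y b" using vq mem ab by (auto simp: Y_def)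
      have Pab: "P a" "\<not> P b" using l Q[of a] Q[of b] ab by auto
      then consider "a < b" | "b < a" by (metis linorder_neqE_nat)
      then show ?thesis
      proof cases
        case 1
        then have "par b = a" using par_eq ab arc by blast
        then show ?thesis using 1 ab vab Pab by (intro exI[of _ b]) auto
      next
        case 2
        then have "par a = b" using par_eq ab symT[OF arc] by blast
        then show ?thesis using 2 ab vab Pab by (intro exI[of _ a]) auto
      qed
    qed
    have Max: "Max ((\<lambda>i. card (X i)) ` pverts T) = t" using width by (simp add: td_width_def)
    show "card (Y j) \<le> t" if "j < N" for j
      unfolding Max[symmetric] Y_def using node[OF that] by (intro Max_ge) auto
    show "finite (Y j)" if "j < N" for j
      unfolding Y_def by (rule finite_subset[OF XG[OF node[OF that]] G.finite_verts])
    show "card {e \<in> {{u, v} | u v. (u, v) \<in> parcs G}. v \<in> e} \<le> max_degree G" for v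
    proof (cases "v \<in> pverts G")
      case True
      have sym: "(y, x) \<in> parcs G" if "(x, y) \<in> parcs G" for x y
        using that G.sym_arcs by (auto simp: symmetric_def sym_def)
      \<comment> \<open>By symmetry of the arcs, every edge at \<open>v\<close> comes from an arc
        leaving \<open>v\<close>.\<close>
      have "{e \<in> {{u, v} | u v. (u, v) \<in> parcs G}. v \<in> e} \<subseteq> (\<lambda>(u, v). {u, v}) ` out_arcs G v"
        using sym by (auto simp: out_arcs_def image_iff)
      then have "card {e \<in> {{u, v} | u v. (u, v) \<in> parcs G}. v \<in> e} \<le> card (out_arcs G v)"
        using surj_card_le[of "out_arcs G v"] G.finite_out_arcs[of v] by blast
      also have "\<dots> \<le> max_degree G"
        unfolding max_degree_def out_degree_def[symmetric] using True by (intro Max_ge) auto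
      finally show ?thesis .
    next
      case False
      then have "{e \<in> {{u, v} | u v. (u, v) \<in> parcs G}. v \<in> e} = {}"
        using G.in_arcsD1 G.in_arcsD2 by auto
      then show ?thesis by (simp only: card.empty)
    qed
    show "0 < length p" using p by (auto simp: vpath_def vwalk_def)
    show "length p \<le> N" by (simp add: N_def hs_def)
    show "par (Suc i) = i" if "Suc i < length p" for i
    proof (rule par_eq)
      show "Suc i < N" using that by (simp add: N_def hs_def)
      have "(p ! i, p ! Suc i) \<in> parcs T"
        using vwalk_arcs_nth[OF that] p by (auto simp: vpath_def vwalk_def)
      then show "(hs ! i, hs ! Suc i) \<in> parcs T" using that by (simp add: hs_def nth_append)
    qed simp
  qed
  moreover have "(\<Union>i<length p. Y i) = (\<Union>x\<in>set p. X x)"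
    by (auto simp: Y_def hs_def nth_append set_conv_nth)
  ultimately show ?thesis by blast
qed

text \<open>The possible weights form a finite set, so the maximum is attained. A one-node path with
  a nonempty bag makes it positive, hence the union on the heaviest path is nonempty.\<close>

lemma max_path_weight_attained:
  fixes G :: "'a pair_pre_digraph" and T :: "'b pair_pre_digraph"
  assumes G: "pair_graph G" and td: "tree_decomposition G T X" and ne: "pverts G \<noteq> {}"
  obtains p where "vpath p T" "path_weight G X p = max_path_weight G T X" "(\<Union>x\<in>set p. X x) \<noteq> {}"
proof -
  interpret G: pair_graph G by (rule G)
  let ?W = "{path_weight G X p | p. vpath p T}"
  have XG: "X x \<subseteq> pverts G" if "x \<in> pverts T" for x
    using td that by (simp add: tree_decomposition_def)
  have "path_weight G X p \<in> (\<lambda>c. real c / real (card (pverts G))) ` {..card (pverts G)}" if "vpath p T" for p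
  proof -
    have "(\<Union>x\<in>set p. X x) \<subseteq> pverts G" using that XG by (force simp: vpath_def vwalk_def)
    then have "card (\<Union>x\<in>set p. X x) \<le> card (pverts G)" by (intro card_mono) auto
    then show ?thesis by (auto simp: path_weight_def)
  qed
  then have fin: "finite ?W" by (intro finite_subset[of ?W "_ ` {..card (pverts G)}"]) auto
  obtain v x where v: "v \<in> pverts G" "x \<in> pverts T" "v \<in> X x"
  proof -
    have "\<forall>v \<in> pverts G. \<exists>i \<in> pverts T. v \<in> X i" using td unfolding tree_decomposition_def by (elim conjE)
    then show thesis using ne that by blast
  qed
  have px: "vpath [x] T" using v by (auto simp: vpath_def vwalk_def)
  have "finite (X x)" using XG v finite_subset G.finite_verts by blast
  then have "0 < path_weight G X [x]"
    using v by (auto simp: path_weight_def card_gt_0_iff intro!: divide_pos_pos)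
  moreover have "path_weight G X [x] \<le> max_path_weight G T X"
    unfolding max_path_weight_def using fin px by (intro Max_ge) auto
  moreover have "max_path_weight G T X \<in> ?W"
    unfolding max_path_weight_def using fin px by (intro Max_in) auto
  ultimately obtain p where p: "vpath p T" "path_weight G X p = max_path_weight G T X" "0 < path_weight G X p"
    by auto
  have "(\<Union>x\<in>set p. X x) \<noteq> {}"
  proof
    assume "(\<Union>x\<in>set p. X x) = {}"
    then have "path_weight G X p = 0" unfolding path_weight_def by (simp only: card.empty)
    then show False using p(3) by simp
  qed
  then show thesis using that p by blast
qed

theorem theorem4p1:
  fixes G :: "'a pair_pre_digraph" and T :: "'b pair_pre_digraph" and X :: "'b \<Rightarrow> 'a set"
    and n t m :: nat
  assumes "pair_graph G" and "card (pverts G) = n"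
    and "tree_decomposition G T X" and "td_width T X = int t - 1"
    and "m \<in> {1..n}"
  shows "\<exists>B W. B \<union> W = pverts G \<and> B \<inter> W = {} \<and> card B = m \<and>
    real (cut_edges G B W) \<le> 1 / 2 * real t * real (max_degree G) *
      ((log 2 (1 / max_path_weight G T X))\<^sup>2 + 9 * log 2 (1 / max_path_weight G T X) + 8)"
proof -
  interpret G: pair_graph G by (rule assms(1))
  have "pverts G \<noteq> {}" using assms(2,5) by auto
  then obtain p where p: "vpath p T" "path_weight G X p = max_path_weight G T X" "(\<Union>x\<in>set p. X x) \<noteq> {}"
    using max_path_weight_attained[OF assms(1,3)] by metis
  let ?E = "{{u, v} | u v. (u, v) \<in> parcs G}"
  obtain N par Y where "rooted_decomposition N (length p) par Y (pverts G) ?E t (max_degree G)"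
    and UN: "(\<Union>i<length p. Y i) = (\<Union>x\<in>set p. X x)"
    using tree_decomposition_rooted[OF assms(1,3,4) p(1)] by (elim exE conjE)
  then interpret rooted_decomposition N "length p" par Y "pverts G" ?E t "max_degree G" by simp
  have "(\<Union>x\<in>set p. X x) \<subseteq> pverts G"
    using assms(3) p(1) by (force simp: tree_decomposition_def vpath_def vwalk_def)
  then have R: "R \<inter> pverts G = (\<Union>x\<in>set p. X x)" using UN by (auto simp: R_def)
  obtain B where B: "B \<subseteq> pverts G" "card B = m"
    "real (card (cross (pverts G) B)) \<le> real t * real (max_degree G) *
       cost (log 2 (real (card (pverts G)) / real (card (R \<inter> pverts G))))"
    using exact_cut[of "pverts G" m] R p(3) assms(2,5) by auto
  \<comment> \<open>The inverse density of \<open>R\<close> in the whole graph is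
    \<open>1 / r\<close>, which turns the logarithm of \<open>exact_cut\<close> into the one
    claimed.\<close>
  have weight: "real (card (pverts G)) / real (card (R \<inter> pverts G)) = 1 / max_path_weight G T X"
    unfolding p(2)[symmetric] R by (simp add: path_weight_def)
  have "{{u, v} | u v. (u, v) \<in> parcs G \<and> u \<in> B \<and> v \<in> pverts G - B} \<subseteq> cross (pverts G) B"
    using G.in_arcsD1 by (auto simp: cross_def)
  then have "cut_edges G B (pverts G - B) \<le> card (cross (pverts G) B)"
    unfolding cut_edges_def using finE by (intro card_mono) (auto simp: cross_def)
  then have "real (cut_edges G B (pverts G - B)) \<le> real t * real (max_degree G) * cost (log 2 (1 / max_path_weight G T X))"
    using B(3) weight by simp
  then show ?thesis using B(1,2)
    by - (rule exI[of _ B], rule exI[of _ "pverts G - B"], auto simp: cost_def)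
qed

end
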